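(* Let $d\ge 1$, $\boldsymbol r\in\mathbb N^d$, $R>0$, $\boldsymbol\sigma=(\sigma_1,\dots,\sigma_d)\in\prod_{l=1}^d(0,r_l+1)$, $0<p<\infty$ and $1\le q\le\infty$ be such that $$H(\boldsymbol\sigma)/d>(1/p-1/q)_+ .$$ Let $p'=\infty$ if $0<p\le 1$ or $p\ge q$, and $p'=p$ if $1<p<q$, and assume that $s\in\mathcal S(\boldsymbol r,\boldsymbol\sigma,p,p',R)$. Then, for all $k\in\mathbb N$, there exists a partition $m$ of $[0,1]^d$ into dyadic rectangles (which may depend on $s,d,\boldsymbol r,\boldsymbol\sigma,p$ and $q$) such that $$|m|\le C_1(d,\boldsymbol\sigma,p)\,2^{kd}$$ and $$\inf_{t\in S_{(m,\boldsymbol r)}}\|s-t\|_q\le C_2(d,\boldsymbol r,\boldsymbol\sigma,p,q)\,R\,2^{-kH(\boldsymbol\sigma)},$$ where $C_1(d,\boldsymbol\sigma,p)$ and $C_2(d,\boldsymbol r,\boldsymbol\sigma,p,q)$ are positive reals that depend only on the parameters indicated.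
   Context: $\mathbb N=\{0,1,2,\dots\}$ and $(x)_+=\max\{x,0\}$. A dyadic rectangle of $[0,1]^d$ is a product $I_1\times\dots\times I_d$ where, for each $l$, $I_l=[0,2^{-j_l}]$ or $I_l=(k_l2^{-j_l},(k_l+1)2^{-j_l}]$ with $j_l\in\mathbb N$, $k_l\in\{1,\dots,2^{j_l}-1\}$. For a partition $m$ of $[0,1]^d$ into (finitely many) dyadic rectangles, $|m|$ is the number of rectangles in $m$, and $S_{(m,\boldsymbol r)}$ is the space of functions on $[0,1]^d$ which, on each rectangle of $m$, are polynomial of degree $\le r_l$ in the $l$-th variable, $l=1,\dots,d$. For $0<p\le\infty$, $\mathbb L_p([0,1]^d)$ is the space of real measurable functions with finite Lebesgue (quasi-)norm $\|\cdot\|_p$ (essential supremum if $p=\infty$), functions being identified when equal almost everywhere. For $\boldsymbol\sigma\in(0,\infty)^d$: $\underline{\boldsymbol\sigma}=\min_l\sigma_l$ and $H(\boldsymbol\sigma)=\big(\frac1d\sum_{l=1}^d\frac1{\sigma_l}\big)^{-1}$. For $j\in\mathbb N$, $\mathcal D_j^{\boldsymbol\sigma}$ is the set of all dyadic rectangles $I_1\times\dots\times I_d$ such that each $I_l$ has length $2^{-\lfloor j\underline{\boldsymbol\sigma}/\sigma_l\rfloor}$; it is a partition of $[0,1]^d$. $\Pi_k^{\boldsymbol r,\boldsymbol\sigma}$ is the set of functions on $[0,1]^d$ that are polynomial of degree $\le r_l$ in the $l$-th variable over each rectangle of $\mathcal D_k^{\boldsymbol\sigma}$. For $s\in\mathbb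 L_p([0,1]^d)$, $$e_{\boldsymbol r,\boldsymbol\sigma,p,k}(s)=\inf_{P\in\Pi_k^{\boldsymbol r,\boldsymbol\sigma}}\|s-P\|_p,$$ $$N_{\boldsymbol r,\boldsymbol\sigma,p,p'}(s)=\Big(\sum_{k\in\mathbb N}(2^{k\underline{\boldsymbol\sigma}}e_{\boldsymbol r,\boldsymbol\sigma,p,k}(s))^{p'}\Big)^{1/p'}\ (0<p'<\infty),\qquad N_{\boldsymbol r,\boldsymbol\sigma,p,\infty}(s)=\sup_{k\in\mathbb N}2^{k\underline{\boldsymbol\sigma}}e_{\boldsymbol r,\boldsymbol\sigma,p,k}(s),$$ and $\mathcal S(\boldsymbol r,\boldsymbol\sigma,p,p',R)=\{s\in\mathbb L_p([0,1]^d): N_{\boldsymbol r,\boldsymbol\sigma,p,p'}(s)\le R\}$. *)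

theory Defs
  imports "HOL-Probability.Essential_Supremum" "HOL-Library.Disjoint_Sets"
begin

abbreviation unit_cube :: "(real ^ 'd::finite) set"
  where "unit_cube \<equiv> cbox 0 1"

definition ennreal_powr :: "ennreal \<Rightarrow> real \<Rightarrow> ennreal"
  where "ennreal_powr x a = (if x = \<infinity> then \<infinity> else ennreal (enn2real x powr a))"
  (* intended only for exponents a > 0 *)

definition Lp_norm :: "ereal \<Rightarrow> (real ^ 'd::finite \<Rightarrow> real) \<Rightarrow> ennreal"
  where "Lp_norm p f =
    (if p = \<infinity> then esssup (lebesgue_on unit_cube) (\<lambda>x. ennreal \<bar>f x\<bar>)
     else ennreal_powr
       (\<integral>\<^sup>+x. ennreal (\<bar>f x\<bar> powr real_of_ereal p) \<partial>lebesgue_on unit_cube)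
       (1 / real_of_ereal p))"

(* Elements are representatives: nothing below depends on values on null sets or outside the cube. *)
definition Lp_space :: "ereal \<Rightarrow> (real ^ 'd::finite \<Rightarrow> real) set"
  where "Lp_space p = {f \<in> borel_measurable (lebesgue_on unit_cube). Lp_norm p f < \<infinity>}"

definition dyadic_interval :: "nat \<Rightarrow> nat \<Rightarrow> real set"
  where "dyadic_interval j k =
    (if k = 0 then {0 .. 1 / 2 ^ j} else {real k / 2 ^ j <.. (real k + 1) / 2 ^ j})"

definition dyadic_rectangles_of_level :: "('d::finite \<Rightarrow> nat) \<Rightarrow> (real ^ 'd) set set"
  where "dyadic_rectangles_of_level j =
    {{x. \<forall>l. x $ l \<in> dyadic_interval (j l) (k l)} | k. \<forall>l. k l < 2 ^ j l}"

definition dyadic_rectangles :: "(real ^ 'd::finite) set set"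
  where "dyadic_rectangles = (\<Union>j. dyadic_rectangles_of_level j)"

definition dyadic_partition :: "(real ^ 'd::finite) set set \<Rightarrow> bool"
  where "dyadic_partition m \<longleftrightarrow>
    finite m \<and> m \<subseteq> dyadic_rectangles \<and> partition_on unit_cube m"

definition poly_on :: "('d::finite \<Rightarrow> nat) \<Rightarrow> (real ^ 'd) set \<Rightarrow> (real ^ 'd \<Rightarrow> real) \<Rightarrow> bool"
  where "poly_on r K f \<longleftrightarrow>
    (\<exists>a. \<forall>x\<in>K. f x = (\<Sum>\<alpha> | \<forall>l. \<alpha> l \<le> r l. a \<alpha> * (\<Prod>l\<in>UNIV. x $ l ^ \<alpha> l)))"

definition piecewise_poly ::
    "(real ^ 'd::finite) set set \<Rightarrow> ('d \<Rightarrow> nat) \<Rightarrow> (real ^ 'd \<Rightarrow> real) set"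
  where "piecewise_poly m r = {f. \<forall>K\<in>m. poly_on r K f}"

definition sigma_min :: "('d::finite \<Rightarrow> real) \<Rightarrow> real"
  where "sigma_min \<sigma> = Min (range \<sigma>)"

definition harmonic_mean :: "('d::finite \<Rightarrow> real) \<Rightarrow> real"
  where "harmonic_mean \<sigma> = inverse (1 / real CARD('d) * (\<Sum>l\<in>UNIV. 1 / \<sigma> l))"

definition aniso_partition :: "('d::finite \<Rightarrow> real) \<Rightarrow> nat \<Rightarrow> (real ^ 'd) set set"
  where "aniso_partition \<sigma> j =
    dyadic_rectangles_of_level (\<lambda>l. nat \<lfloor>real j * sigma_min \<sigma> / \<sigma> l\<rfloor>)"

definition approx_error ::
    "('d::finite \<Rightarrow> nat) \<Rightarrow> ('d \<Rightarrow> real) \<Rightarrow> ereal \<Rightarrow> nat \<Rightarrow> (real ^ 'd \<Rightarrow> real) \<Rightarrow> ennreal"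
  where "approx_error r \<sigma> p k s =
    (INF P\<in>piecewise_poly (aniso_partition \<sigma> k) r. Lp_norm p (\<lambda>x. s x - P x))"

definition besov_seminorm ::
    "('d::finite \<Rightarrow> nat) \<Rightarrow> ('d \<Rightarrow> real) \<Rightarrow> ereal \<Rightarrow> ereal \<Rightarrow> (real ^ 'd \<Rightarrow> real) \<Rightarrow> ennreal"
  where "besov_seminorm r \<sigma> p p' s =
    (if p' = \<infinity>
     then (SUP k. ennreal (2 powr (real k * sigma_min \<sigma>)) * approx_error r \<sigma> p k s)
     else ennreal_powr
       (\<Sum>k. ennreal_powr (ennreal (2 powr (real k * sigma_min \<sigma>)) * approx_error r \<sigma> p k s)
         (real_of_ereal p'))
       (1 / real_of_ereal p'))"

definition besov_ball ::
    "('d::finite \<Rightarrow> nat) \<Rightarrow> ('d \<Rightarrow> real) \<Rightarrow> ereal \<Rightarrow> ereal \<Rightarrow> real \<Rightarrow> (real ^ 'd \<Rightarrow> real) set"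
  where "besov_ball r \<sigma> p p' R =
    {s \<in> Lp_space p. besov_seminorm r \<sigma> p p' s \<le> ennreal R}"

definition second_index :: "real \<Rightarrow> ereal \<Rightarrow> ereal"
  where "second_index p q = (if p \<le> 1 \<or> ereal p \<ge> q then \<infinity> else ereal p)"

end

theory Submission
  imports Defs
begin

text \<open>
  Choose near-best approximants \<open>P\<^sub>n\<close> of \<open>s\<close> on the uniform anisotropic partitions, so that the
  increments \<open>g\<^sub>i = P\<^sub>i - P\<^sub>i\<^sub>-\<^sub>1\<close> have \<open>L\<^sub>p\<close> norm of order \<open>R 2\<^sup>-\<^sup>i\<^sup>\<sigma>\<close>, the exponent
  \<open>\<sigma>\<close> being the smallest \<open>\<sigma>\<^sub>l\<close>. Start from the level \<open>J\<close> with about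
  \<open>2\<^sup>k\<^sup>d\<close> cells and stop refining around a point as soon as its cell contains no point where some
  later \<open>g\<^sub>i\<close> exceeds a threshold \<open>M\<^sub>i\<close>. On a cell, the supremum of a polynomial is controlled by its
  \<open>L\<^sub>p\<close> mean, so the \<open>L\<^sub>p\<close> bound on \<open>g\<^sub>i\<close> limits the number of cells of level \<open>i\<close> where the threshold
  is exceeded; \<open>M\<^sub>i\<close> is chosen such that this number decays geometrically in \<open>i - J\<close>. The error of
  the stopped approximant is the sum of the parts of the \<open>g\<^sub>i\<close> below the threshold, whose
  \<open>L\<^sub>q\<close> norms decay geometrically by interpolation between \<open>L\<^sub>p\<close> and \<open>L\<^sub>\<infinity>\<close>, thanks to the strict
  inequality between \<open>H(\<sigma>) / d\<close> and \<open>1/p - 1/q\<close>. The Besov seminorm enters only through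
  the bounds \<open>R 2\<^sup>-\<^sup>i\<^sup>\<sigma>\<close> on the single approximation errors, for either value of \<open>p'\<close>; the case \<open>q \<le> p\<close>
  reduces to an exponent slightly larger than \<open>p\<close>. Multiplying all thresholds by a large constant
  makes the cardinality constant independent of \<open>r\<close> and \<open>q\<close>.
\<close>

section \<open>Suprema of polynomials on convex sets\<close>

text \<open>The construction yields the coefficients of (1 - X)^n: each induction step multiplies by
  1 - X, that is, takes one more difference, and so annihilates one more degree. The normalisation
  \<open>c 0 = 1\<close> lets the value at node 0 be expressed by the other nodes.\<close>

lemma finite_difference_weights:
  "\<exists>c :: nat \<Rightarrow> real. c 0 = 1 \<and> (\<forall>i>n. c i = 0) \<and> (\<forall>k<n. (\<Sum>i\<le>n. c i * real i ^ k) = 0)"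
proof (induction n)
  case 0
  show ?case by (intro exI[of _ "\<lambda>i. if i = 0 then 1 else 0"]) auto
next
  case (Suc n)
  then obtain c :: "nat \<Rightarrow> real" where c: "c 0 = 1" "\<And>i. i > n \<Longrightarrow> c i = 0"
    "\<And>k. k < n \<Longrightarrow> (\<Sum>i\<le>n. c i * real i ^ k) = 0" by blast
  define c' where "c' i = c i - (if i = 0 then 0 else c (i - 1))" for i
  have "(\<Sum>i\<le>Suc n. c' i * real i ^ k) = 0" if k: "k < Suc n" for k
  proof -
    have "(\<Sum>i\<le>Suc n. c' i * real i ^ k)
        = (\<Sum>i\<le>Suc n. c i * real i ^ k) - (\<Sum>i\<le>Suc n. (if i = 0 then 0 else c (i - 1)) * real i ^ k)"
      unfolding c'_def by (simp add: algebra_simps sum_subtractf del: sum.atMost_Suc)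
    also have "(\<Sum>i\<le>Suc n. (if i = 0 then 0 else c (i - 1)) * real i ^ k) = (\<Sum>i\<le>n. c i * real (Suc i) ^ k)"
      by (subst sum.atMost_Suc_shift) simp
    also have "\<dots> = (\<Sum>i\<le>n. \<Sum>m\<le>k. of_nat (k choose m) * (c i * real i ^ m))"
    proof (rule sum.cong[OF refl])
      fix i
      have "real (Suc i) ^ k = (\<Sum>m\<le>k. of_nat (k choose m) * real i ^ m)"
        using binomial_ring[of "real i" 1 k] by (simp add: add.commute)
      then show "c i * real (Suc i) ^ k = (\<Sum>m\<le>k. of_nat (k choose m) * (c i * real i ^ m))"
        by (simp add: sum_distrib_left algebra_simps)
    qed
    also have "\<dots> = (\<Sum>m\<le>k. of_nat (k choose m) * (\<Sum>i\<le>n. c i * real i ^ m))"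
      by (subst sum.swap) (simp add: sum_distrib_left)
    \<comment> \<open>The lower powers \<open>m < k\<close> vanish by the induction hypothesis; the
      remaining term \<open>m = k\<close> cancels the unshifted sum, whose extra summand vanishes
      because \<open>c (Suc n) = 0\<close>.\<close>
    also have "\<dots> = (\<Sum>m\<in>{k}. of_nat (k choose m) * (\<Sum>i\<le>n. c i * real i ^ m))"
      using k c(3) by (intro sum.mono_neutral_right) auto
    finally show ?thesis using c(2)[of "Suc n"] by simp
  qed
  then show ?case using c by (intro exI[of _ c']) (auto simp: c'_def)
qed

text \<open>Every term is at most the maximum, whose power occurs on the right. This crude bound
  covers \<open>p < 1\<close> and \<open>p \<ge> 1\<close> alike.\<close>

lemma sum_powr_le:
  fixes a :: "'a \<Rightarrow> real"
  assumes "finite A" "\<And>i. i \<in> A \<Longrightarrow> 0 \<le> a i" "0 < p"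
  shows "(\<Sum>i\<in>A. a i) powr p \<le> real (card A) powr p * (\<Sum>i\<in>A. a i powr p)"
proof (cases "A = {}")
  case False
  define b where "b = Max (a ` A)"
  have b: "b \<in> a ` A" "\<And>i. i \<in> A \<Longrightarrow> a i \<le> b"
    using False assms(1) by (auto simp: b_def)
  have "(\<Sum>i\<in>A. a i) \<le> real (card A) * b" using sum_bounded_above[of A a b] b by simp
  then have "(\<Sum>i\<in>A. a i) powr p \<le> (real (card A) * b) powr p"
    using assms by (intro powr_mono2 sum_nonneg) auto
  also have "\<dots> = real (card A) powr p * b powr p" using b assms by (auto simp: powr_mult)
  also have "b powr p \<le> (\<Sum>i\<in>A. a i powr p)"
    using b assms by (auto intro!: member_le_sum)
  finally show ?thesis by (simp add: mult_left_mono)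
qed simp

lemma finite_multi_index: "finite {\<alpha> :: 'd::finite \<Rightarrow> nat. \<forall>l. \<alpha> l \<le> r l}"
proof -
  have "{\<alpha> :: 'd \<Rightarrow> nat. \<forall>l. \<alpha> l \<le> r l} \<subseteq> PiE UNIV (\<lambda>l. {..r l})" by auto
  then show ?thesis by (rule finite_subset) (auto intro: finite_PiE)
qed

text \<open>Along a segment each coordinate is affine in \<open>t\<close>, so a monomial has degree
  at most the sum of the \<open>r l\<close>. Multivariate questions reduce to one variable, with a
  degree bound independent of \<open>K\<close> and of the segment.\<close>

lemma poly_on_segment:
  fixes K :: "(real ^ 'd::finite) set"
  assumes "poly_on r K f" "convex K" "x \<in> K" "y \<in> K"
  obtains q where "degree q \<le> (\<Sum>l\<in>UNIV. r l)"
    "\<And>t. t \<in> {0..1} \<Longrightarrow> f (x + t *\<^sub>R (y - x)) = poly q t"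
proof -
  obtain a where a: "\<And>z. z \<in> K \<Longrightarrow> f z = (\<Sum>\<alpha> | \<forall>l. \<alpha> l \<le> r l. a \<alpha> * (\<Prod>l\<in>UNIV. z $ l ^ \<alpha> l))"
    using assms(1) unfolding poly_on_def by blast
  define Q where "Q = (\<Sum>\<alpha> | \<forall>l. \<alpha> l \<le> r l. smult (a \<alpha>) (\<Prod>l\<in>UNIV. [:x $ l, y $ l - x $ l:] ^ \<alpha> l))"
  have "degree Q \<le> (\<Sum>l\<in>UNIV. r l)" unfolding Q_def
  proof (rule degree_sum_le[OF finite_multi_index])
    fix \<alpha> assume \<alpha>: "\<alpha> \<in> {\<alpha>. \<forall>l. \<alpha> l \<le> r l}"
    have "degree (smult (a \<alpha>) (\<Prod>l\<in>UNIV. [:x $ l, y $ l - x $ l:] ^ \<alpha> l))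
       \<le> degree (\<Prod>l\<in>UNIV. [:x $ l, y $ l - x $ l:] ^ \<alpha> l)" by (rule degree_smult_le)
    also have "\<dots> \<le> (\<Sum>l\<in>UNIV. degree ([:x $ l, y $ l - x $ l:] ^ \<alpha> l))"
      using degree_prod_sum_le[of UNIV "\<lambda>l. [:x $ l, y $ l - x $ l:] ^ \<alpha> l"] by (simp add: o_def)
    also have "\<dots> \<le> (\<Sum>l\<in>UNIV. r l)"
    proof (rule sum_mono)
      fix l
      have "degree ([:x $ l, y $ l - x $ l:] ^ \<alpha> l) \<le> degree [:x $ l, y $ l - x $ l:] * \<alpha> l"
        by (rule degree_power_le)
      also have "\<dots> \<le> 1 * \<alpha> l" by (intro mult_right_mono) auto
      finally show "degree ([:x $ l, y $ l - x $ l:] ^ \<alpha> l) \<le> r l" using \<alpha> by (auto intro: le_trans)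
    qed
    finally show "degree (smult (a \<alpha>) (\<Prod>l\<in>UNIV. [:x $ l, y $ l - x $ l:] ^ \<alpha> l)) \<le> (\<Sum>l\<in>UNIV. r l)" .
  qed
  moreover have "f (x + t *\<^sub>R (y - x)) = poly Q t" if "t \<in> {0..1}" for t
  proof -
    have "(1 - t) *\<^sub>R x + t *\<^sub>R y \<in> K" using that assms convex_alt by fastforce
    then have "x + t *\<^sub>R (y - x) \<in> K" by (simp add: algebra_simps)
    from a[OF this] show ?thesis by (simp add: Q_def poly_sum poly_prod)
  qed
  ultimately show ?thesis using that by blast
qed

lemma nn_integral_lborel_affine:
  fixes t :: "'a::euclidean_space"
  assumes [measurable]: "G \<in> borel_measurable borel" and "c \<noteq> 0"
  shows "(\<integral>\<^sup>+x. G x \<partial>lborel) = ennreal (\<bar>c\<bar> ^ DIM('a)) * (\<integral>\<^sup>+x. G (t + c *\<^sub>R x) \<partial>lborel)"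
  by (subst lborel_affine[OF assms(2), of t])
     (simp add: nn_integral_density nn_integral_distr nn_integral_cmult)

text \<open>A coefficient family gives a globally defined Borel function; a piece that is polynomial
  only on a cell is replaced by it whenever measurability matters.\<close>

definition box_polynomial :: "('d::finite \<Rightarrow> nat) \<Rightarrow> (('d \<Rightarrow> nat) \<Rightarrow> real) \<Rightarrow> real ^ 'd \<Rightarrow> real"
  where "box_polynomial r a x = (\<Sum>\<alpha> | \<forall>l. \<alpha> l \<le> r l. a \<alpha> * (\<Prod>l\<in>UNIV. x $ l ^ \<alpha> l))"

lemma borel_measurable_box_polynomial [measurable]: "box_polynomial r a \<in> borel_measurable borel"
  unfolding box_polynomial_def by measurable

text \<open>A polynomial of degree below \<open>n\<close> along a segment issued from \<open>x\<close> is determined at \<open>x\<close> by its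
  values at \<open>n\<close> further equispaced points (vanishing of the \<open>n\<close>-th difference). Averaging over
  the endpoint of the segment, and contracting \<open>K\<close> towards \<open>x\<close>, bounds the value at \<open>x\<close>.\<close>

lemma polynomial_sup_le_Lp:
  fixes r :: "'d::finite \<Rightarrow> nat"
  assumes "0 < p"
  obtains C where "0 < C"
    "\<And>(K :: (real ^ 'd) set) f x. convex K \<Longrightarrow> K \<in> sets borel \<Longrightarrow> poly_on r K f \<Longrightarrow> x \<in> K \<Longrightarrow>
      ennreal (\<bar>f x\<bar> powr p) * emeasure lborel K
        \<le> ennreal C * (\<integral>\<^sup>+y. ennreal (\<bar>f y\<bar> powr p) * indicator K y \<partial>lborel)"
proof -
  \<comment> \<open>\<open>n\<close> exceeds the degree along every segment, so the
    \<open>n\<close>-th difference at the nodes \<open>h i\<close> in [0,1] vanishes.\<close>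
  define n where "n = Suc (\<Sum>l\<in>UNIV. r l)"
  obtain c :: "nat \<Rightarrow> real" where c: "c 0 = 1" "\<And>i. i > n \<Longrightarrow> c i = 0"
    "\<And>k. k < n \<Longrightarrow> (\<Sum>i\<le>n. c i * real i ^ k) = 0" using finite_difference_weights[of n] by blast
  define h where "h i = real i / real n" for i
  have n0: "n > 0" by (simp add: n_def)
  have h: "h i > 0" "h i \<le> 1" if "i \<in> {1..n}" for i using that n0 by (auto simp: h_def)
  \<comment> \<open>\<open>real n powr p\<close> comes from \<open>sum_powr_le\<close>, and the
    reciprocal power of \<open>h i\<close> is the Jacobian factor of the contraction towards
    \<open>x\<close> by \<open>h i\<close>.\<close>
  define C where "C = real n powr p * (\<Sum>i\<in>{1..n}. \<bar>c i\<bar> powr p * (1 / h i ^ DIM(real^'d)))"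
  have C0: "C \<ge> 0" unfolding C_def using h by (auto intro!: mult_nonneg_nonneg sum_nonneg simp: less_imp_le)
  have "ennreal (\<bar>f x\<bar> powr p) * emeasure lborel K
        \<le> ennreal C * (\<integral>\<^sup>+y. ennreal (\<bar>f y\<bar> powr p) * indicator K y \<partial>lborel)"
    if K: "convex K" and Kb: "K \<in> sets borel" and f: "poly_on r K f" and x: "x \<in> K"
    for K :: "(real ^ 'd) set" and f x
  proof -
    obtain a where a: "\<And>z. z \<in> K \<Longrightarrow> f z = box_polynomial r a z"
      using f unfolding poly_on_def box_polynomial_def by blast
    \<comment> \<open>The cutoff outside \<open>K\<close> lets the change of variables run over the
      whole space; by convexity the contracted points of \<open>K\<close> stay in \<open>K\<close>,
      where the cutoff is 1.\<close>
    define G where "G z = ennreal (\<bar>box_polynomial r a z\<bar> powr p) * indicator K z" for z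
    have Gm[measurable]: "G \<in> borel_measurable borel" unfolding G_def using Kb by measurable
    have Geq: "(\<integral>\<^sup>+y. ennreal (\<bar>f y\<bar> powr p) * indicator K y \<partial>lborel) = (\<integral>\<^sup>+y. G y \<partial>lborel)"
      by (rule nn_integral_cong) (auto simp: G_def a indicator_def)
    have seg: "x + t *\<^sub>R (y - x) \<in> K" if "t \<in> {0..1}" "y \<in> K" for t y
    proof -
      have "(1 - t) *\<^sub>R x + t *\<^sub>R y \<in> K" using that x K convex_alt by fastforce
      then show ?thesis by (simp add: algebra_simps)
    qed
    have pt: "ennreal (\<bar>f x\<bar> powr p) * indicator K y
        \<le> (\<Sum>i\<in>{1..n}. ennreal (real n powr p * \<bar>c i\<bar> powr p) * G ((x - h i *\<^sub>R x) + h i *\<^sub>R y))" for y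
    proof (cases "y \<in> K")
      case True
      obtain q where q: "degree q \<le> (\<Sum>l\<in>UNIV. r l)"
        "\<And>t. t \<in> {0..1} \<Longrightarrow> f (x + t *\<^sub>R (y - x)) = poly q t"
        using poly_on_segment[OF f K x True] by blast
      have "(\<Sum>i\<le>n. c i * poly q (h i)) = (\<Sum>i\<le>n. \<Sum>k\<le>degree q. (coeff q k / real n ^ k) * (c i * real i ^ k))"
        by (simp add: poly_altdef h_def sum_distrib_left power_divide mult_ac)
      also have "\<dots> = (\<Sum>k\<le>degree q. (coeff q k / real n ^ k) * (\<Sum>i\<le>n. c i * real i ^ k))"
        by (subst sum.swap) (simp add: sum_distrib_left)
      also have "\<dots> = 0" using q(1) c(3) by (auto intro!: sum.neutral simp: n_def)
      finally have z: "(\<Sum>i\<le>n. c i * poly q (h i)) = 0" .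
      have "{..n} = insert 0 {1..n}" by auto
      then have "f x = - (\<Sum>i\<in>{1..n}. c i * f (x + h i *\<^sub>R (y - x)))"
        using z c(1) q(2)[of 0] q(2) h by (simp add: h_def[of 0] less_imp_le)
      then have "\<bar>f x\<bar> \<le> (\<Sum>i\<in>{1..n}. \<bar>c i\<bar> * \<bar>f (x + h i *\<^sub>R (y - x))\<bar>)"
        by (simp add: abs_mult[symmetric] sum_abs)
      then have "\<bar>f x\<bar> powr p \<le> (\<Sum>i\<in>{1..n}. \<bar>c i\<bar> * \<bar>f (x + h i *\<^sub>R (y - x))\<bar>) powr p"
        using assms by (intro powr_mono2) auto
      also have "\<dots> \<le> real n powr p * (\<Sum>i\<in>{1..n}. (\<bar>c i\<bar> * \<bar>f (x + h i *\<^sub>R (y - x))\<bar>) powr p)"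
        using sum_powr_le[of "{1..n}" "\<lambda>i. \<bar>c i\<bar> * \<bar>f (x + h i *\<^sub>R (y - x))\<bar>" p] assms by auto
      also have "\<dots> = (\<Sum>i\<in>{1..n}. (real n powr p * \<bar>c i\<bar> powr p) * \<bar>f (x + h i *\<^sub>R (y - x))\<bar> powr p)"
        by (simp add: sum_distrib_left powr_mult mult_ac)
      finally have le: "\<bar>f x\<bar> powr p \<le> \<dots>" .
      have "ennreal (\<bar>f x\<bar> powr p) * indicator K y \<le> ennreal (\<Sum>i\<in>{1..n}. (real n powr p * \<bar>c i\<bar> powr p) * \<bar>f (x + h i *\<^sub>R (y - x))\<bar> powr p)"
        using True le by (simp add: ennreal_leI)
      also have "\<dots> = (\<Sum>i\<in>{1..n}. ennreal (real n powr p * \<bar>c i\<bar> powr p) * ennreal (\<bar>f (x + h i *\<^sub>R (y - x))\<bar> powr p))"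
        by (simp add: sum_ennreal[symmetric] ennreal_mult)
      also have "\<dots> = (\<Sum>i\<in>{1..n}. ennreal (real n powr p * \<bar>c i\<bar> powr p) * G ((x - h i *\<^sub>R x) + h i *\<^sub>R y))"
      proof (rule sum.cong[OF refl])
        fix i assume i: "i \<in> {1..n}"
        have "x + h i *\<^sub>R (y - x) \<in> K" using seg h[OF i] True by auto
        then show "ennreal (real n powr p * \<bar>c i\<bar> powr p) * ennreal (\<bar>f (x + h i *\<^sub>R (y - x))\<bar> powr p)
          = ennreal (real n powr p * \<bar>c i\<bar> powr p) * G ((x - h i *\<^sub>R x) + h i *\<^sub>R y)"
          using a by (simp add: G_def algebra_simps)
      qed
      finally show ?thesis .
    qed simp
    have "ennreal (\<bar>f x\<bar> powr p) * emeasure lborel K = (\<integral>\<^sup>+y. ennreal (\<bar>f x\<bar> powr p) * indicator K y \<partial>lborel)"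
      using Kb by (simp add: nn_integral_cmult_indicator)
    also have "\<dots> \<le> (\<integral>\<^sup>+y. (\<Sum>i\<in>{1..n}. ennreal (real n powr p * \<bar>c i\<bar> powr p) * G ((x - h i *\<^sub>R x) + h i *\<^sub>R y)) \<partial>lborel)"
      by (rule nn_integral_mono) (use pt in auto)
    also have "\<dots> = (\<Sum>i\<in>{1..n}. ennreal (real n powr p * \<bar>c i\<bar> powr p) * (\<integral>\<^sup>+y. G ((x - h i *\<^sub>R x) + h i *\<^sub>R y) \<partial>lborel))"
      by (subst nn_integral_sum) (auto simp: nn_integral_cmult)
    also have "\<dots> = (\<Sum>i\<in>{1..n}. ennreal (real n powr p * (\<bar>c i\<bar> powr p * (1 / h i ^ DIM(real^'d)))) * (\<integral>\<^sup>+y. G y \<partial>lborel))"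
    proof (rule sum.cong[OF refl])
      fix i assume i: "i \<in> {1..n}"
      define I where "I = (\<integral>\<^sup>+y. G ((x - h i *\<^sub>R x) + h i *\<^sub>R y) \<partial>lborel)"
      have "(\<integral>\<^sup>+y. G y \<partial>lborel) = ennreal (h i ^ DIM(real^'d)) * I"
        using nn_integral_lborel_affine[OF Gm, of "h i" "x - h i *\<^sub>R x"] h[OF i] by (simp add: I_def)
      moreover have "ennreal (1 / h i ^ DIM(real^'d)) * ennreal (h i ^ DIM(real^'d)) = 1"
        using h[OF i] by (subst ennreal_mult[symmetric]) auto
      ultimately have "I = ennreal (1 / h i ^ DIM(real^'d)) * (\<integral>\<^sup>+y. G y \<partial>lborel)"
        by (simp add: mult.assoc[symmetric] del: DIM_cart)
      then show "ennreal (real n powr p * \<bar>c i\<bar> powr p) * (\<integral>\<^sup>+y. G ((x - h i *\<^sub>R x) + h i *\<^sub>R y) \<partial>lborel)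
          = ennreal (real n powr p * (\<bar>c i\<bar> powr p * (1 / h i ^ DIM(real^'d)))) * (\<integral>\<^sup>+y. G y \<partial>lborel)"
        using h[OF i] unfolding I_def[symmetric]
        by (simp add: ennreal_mult' mult.assoc del: DIM_cart times_divide_eq_right mult_1_right)
    qed
    also have "\<dots> = ennreal C * (\<integral>\<^sup>+y. G y \<partial>lborel)"
      unfolding C_def sum_distrib_left using h
      by (subst sum_ennreal[symmetric]) (auto simp: sum_distrib_right less_imp_le)
    finally show ?thesis unfolding Geq .
  qed
  \<comment> \<open>Adding 1 only makes the constant strictly positive.\<close>
  then show ?thesis using C0
    by (intro that[of "C + 1"]) (fastforce intro: order_trans mult_right_mono ennreal_leI)+
qed

section \<open>Dyadic cells\<close>

text \<open>The intervals are open on the left, hence the ceiling minus one; truncation by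
  \<open>nat\<close> sends \<open>x = 0\<close> to index 0, in accordance with the closed first
  interval.\<close>

definition dyadic_index :: "nat \<Rightarrow> real \<Rightarrow> nat"
  where "dyadic_index j x = nat (\<lceil>2 ^ j * x\<rceil> - 1)"

lemma dyadic_interval_iff:
  assumes "0 \<le> x" "x \<le> 1" "k < 2 ^ j"
  shows "x \<in> dyadic_interval j k \<longleftrightarrow> dyadic_index j x = k"
proof (cases "k = 0")
  case True
  have "x \<in> dyadic_interval j 0 \<longleftrightarrow> 2 ^ j * x \<le> 1"
    using assms by (simp add: dyadic_interval_def field_simps)
  also have "\<dots> \<longleftrightarrow> \<lceil>2 ^ j * x\<rceil> \<le> 1" by (simp add: ceiling_le_iff)
  finally show ?thesis using True by (simp add: dyadic_index_def)
next
  case False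
  have "x \<in> dyadic_interval j k \<longleftrightarrow> real k < 2 ^ j * x \<and> 2 ^ j * x \<le> real k + 1"
    using assms False by (simp add: dyadic_interval_def field_simps)
  also have "\<dots> \<longleftrightarrow> \<lceil>2 ^ j * x\<rceil> = int k + 1" by (simp add: ceiling_eq_iff)
  also have "\<dots> \<longleftrightarrow> dyadic_index j x = k" using False by (auto simp: dyadic_index_def)
  finally show ?thesis .
qed

lemma dyadic_index_less:
  assumes "x \<le> 1" shows "dyadic_index j x < 2 ^ j"
proof -
  have "2 ^ j * x \<le> 2 ^ j" using assms by simp
  then have "\<lceil>2 ^ j * x\<rceil> \<le> 2 ^ j" by (simp add: ceiling_le_iff)
  moreover have "(0::int) < 2 ^ j" by simp
  ultimately have "nat (\<lceil>2 ^ j * x\<rceil> - 1) < nat (2 ^ j)" by linarith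
  then show ?thesis by (simp add: dyadic_index_def nat_power_eq)
qed

text \<open>Doubling \<open>y\<close> makes the ceiling \<open>2 * \<lceil>y\<rceil>\<close> or one
  less, so both halves of an interval have the same parent. The nestedness of the cells rests on
  this.\<close>

lemma dyadic_index_Suc: "dyadic_index (Suc j) x div 2 = dyadic_index j x"
proof -
  define y where "y = 2 ^ j * x"
  have "\<lceil>2 * y\<rceil> = 2 * \<lceil>y\<rceil> \<or> \<lceil>2 * y\<rceil> = 2 * \<lceil>y\<rceil> - 1" by linarith
  then have "nat (\<lceil>2 * y\<rceil> - 1) div 2 = nat (\<lceil>y\<rceil> - 1)" by auto
  then show ?thesis by (simp add: dyadic_index_def y_def mult.assoc)
qed

lemma dyadic_index_eq_mono:
  assumes "dyadic_index j x = dyadic_index j y" "i \<le> j"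
  shows "dyadic_index i x = dyadic_index i y"
  using assms(2,1) by (induction rule: dec_induct) (metis dyadic_index_Suc)+

text \<open>Cells are addressed by a point of the cube that they contain instead of an index vector,
  so that comparing cells becomes comparing values of \<open>dyadic_index\<close>.\<close>

definition dyadic_cell :: "('d::finite \<Rightarrow> nat) \<Rightarrow> real ^ 'd \<Rightarrow> (real ^ 'd) set"
  where "dyadic_cell u x = {y. \<forall>l. y $ l \<in> dyadic_interval (u l) (dyadic_index (u l) (x $ l))}"

lemma mem_unit_cube: "x \<in> unit_cube \<longleftrightarrow> (\<forall>l. 0 \<le> x $ l \<and> x $ l \<le> 1)"
  by (simp add: mem_box_cart)

lemma dyadic_interval_subset:
  assumes "k < 2 ^ j" shows "dyadic_interval j k \<subseteq> {0..1}"
proof -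
  have "real (Suc k) \<le> real (2 ^ j)" using assms by (intro of_nat_mono) simp
  then have "(real k + 1) / 2 ^ j \<le> 1" by (simp add: add.commute)
  have "1 / 2 ^ j \<le> (1::real)" "0 \<le> real k / 2 ^ j" by simp_all
  have "z \<in> {0..1}" if "z \<in> dyadic_interval j k" for z
  proof (cases "k = 0")
    case True
    then have "0 \<le> z \<and> z \<le> 1 / 2 ^ j" using that by (simp add: dyadic_interval_def)
    then show ?thesis using \<open>1 / 2 ^ j \<le> (1::real)\<close> unfolding atLeastAtMost_iff by linarith
  next
    case False
    then have "real k / 2 ^ j < z \<and> z \<le> (real k + 1) / 2 ^ j" using that by (simp add: dyadic_interval_def)
    then show ?thesis using \<open>(real k + 1) / 2 ^ j \<le> 1\<close> \<open>0 \<le> real k / 2 ^ j\<close>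
      unfolding atLeastAtMost_iff by linarith
  qed
  then show ?thesis by blast
qed

lemma mem_dyadic_cell:
  assumes "x \<in> unit_cube"
  shows "y \<in> dyadic_cell u x \<longleftrightarrow> y \<in> unit_cube \<and> (\<forall>l. dyadic_index (u l) (y $ l) = dyadic_index (u l) (x $ l))"
proof -
  have "\<And>l. dyadic_index (u l) (x $ l) < 2 ^ u l" using assms by (simp add: dyadic_index_less mem_unit_cube)
  then show ?thesis unfolding dyadic_cell_def mem_Collect_eq mem_unit_cube
    using dyadic_interval_iff dyadic_interval_subset by (metis atLeastAtMost_iff subsetD)
qed

lemma dyadic_cell_self: "x \<in> unit_cube \<Longrightarrow> x \<in> dyadic_cell u x"
  by (simp add: mem_dyadic_cell)

lemma dyadic_cell_subset: "x \<in> unit_cube \<Longrightarrow> dyadic_cell u x \<subseteq> unit_cube"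
  by (auto simp: mem_dyadic_cell)

lemma dyadic_cell_eq: "x \<in> unit_cube \<Longrightarrow> y \<in> dyadic_cell u x \<Longrightarrow> dyadic_cell u y = dyadic_cell u x"
  by (subst (asm) mem_dyadic_cell) (simp_all add: dyadic_cell_def)

lemma dyadic_cell_mono:
  "x \<in> unit_cube \<Longrightarrow> u \<le> v \<Longrightarrow> dyadic_cell v x \<subseteq> dyadic_cell u x"
  by (auto simp: mem_dyadic_cell le_fun_def) (metis dyadic_index_eq_mono)

lemma dyadic_rectangles_of_level_eq: "dyadic_rectangles_of_level u = dyadic_cell u ` unit_cube"
proof (intro equalityI subsetI)
  fix K assume "K \<in> dyadic_rectangles_of_level u"
  then obtain k where K: "K = {x. \<forall>l. x $ l \<in> dyadic_interval (u l) (k l)}" and k: "\<And>l. k l < 2 ^ u l"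
    by (auto simp: dyadic_rectangles_of_level_def)
  \<comment> \<open>The right endpoint belongs to the interval for \<open>k l = 0\<close> as well as
    for \<open>k l > 0\<close>, so this corner lies in the cell.\<close>
  define x :: "real ^ 'a" where "x = (\<chi> l. (real (k l) + 1) / 2 ^ u l)"
  have x: "x $ l \<in> dyadic_interval (u l) (k l)" for l
    by (auto simp: x_def dyadic_interval_def field_simps)
  then have "x \<in> unit_cube" using dyadic_interval_subset[OF k] unfolding mem_unit_cube by (metis atLeastAtMost_iff subsetD)
  moreover from this x have "\<And>l. dyadic_index (u l) (x $ l) = k l"
    by (subst dyadic_interval_iff[symmetric]) (use k in \<open>auto simp: mem_unit_cube\<close>)
  ultimately show "K \<in> dyadic_cell u ` unit_cube" by (auto simp: K dyadic_cell_def intro!: image_eqI[of _ _ x])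
next
  fix K assume "K \<in> dyadic_cell u ` unit_cube"
  then show "K \<in> dyadic_rectangles_of_level u"
    by (auto simp: dyadic_cell_def dyadic_rectangles_of_level_def mem_unit_cube dyadic_index_less)
qed

lemma finite_dyadic_rectangles_of_level: "finite (dyadic_rectangles_of_level (u :: 'd::finite \<Rightarrow> nat))"
proof -
  have "{k :: 'd \<Rightarrow> nat. \<forall>l. k l < 2 ^ u l} \<subseteq> PiE UNIV (\<lambda>l. {..<2 ^ u l})" by auto
  then have "finite {k :: 'd \<Rightarrow> nat. \<forall>l. k l < 2 ^ u l}" by (rule finite_subset) (auto intro: finite_PiE)
  then show ?thesis unfolding dyadic_rectangles_of_level_def by simp
qed

text \<open>The mixture of closed and half-open sides is bypassed by squeezing the cell between an
  open and a closed box of the same volume; \<open>emeasure_dyadic_cell\<close> reads off the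
  measure from this.\<close>

lemma dyadic_cell_sandwich:
  fixes u :: "'d::finite \<Rightarrow> nat" and x :: "real ^ 'd"
  obtains a b where "box a b \<subseteq> dyadic_cell u x" "dyadic_cell u x \<subseteq> cbox a b" "\<And>l. b $ l - a $ l = 1 / 2 ^ u l"
proof -
  define a b :: "real ^ 'd" where "a = (\<chi> l. real (dyadic_index (u l) (x $ l)) / 2 ^ u l)"
    and "b = (\<chi> l. (real (dyadic_index (u l) (x $ l)) + 1) / 2 ^ u l)"
  have "box a b \<subseteq> dyadic_cell u x"
    by (auto simp: mem_box_cart dyadic_cell_def dyadic_interval_def a_def b_def less_imp_le split: if_splits)
      (metis div_0 less_imp_le of_nat_0 add_0)+
  moreover have "dyadic_cell u x \<subseteq> cbox a b"
  proof
    fix y assume y: "y \<in> dyadic_cell u x"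
    have "a $ l \<le> y $ l \<and> y $ l \<le> b $ l" for l
    proof -
      have "y $ l \<in> dyadic_interval (u l) (dyadic_index (u l) (x $ l))" using y by (simp add: dyadic_cell_def)
      then show ?thesis by (auto simp: a_def b_def dyadic_interval_def split: if_splits)
    qed
    then show "y \<in> cbox a b" by (simp add: mem_box_cart)
  qed
  moreover have "b $ l - a $ l = 1 / 2 ^ u l" for l by (simp add: a_def b_def add_divide_distrib)
  ultimately show ?thesis using that by blast
qed

lemma dyadic_cell_borel [measurable]: "dyadic_cell u x \<in> sets borel"
proof -
  have [measurable]: "dyadic_interval j k \<in> sets borel" for j k by (simp add: dyadic_interval_def)
  have "dyadic_cell u x = (\<Inter>l. (\<lambda>y. y $ l) -` dyadic_interval (u l) (dyadic_index (u l) (x $ l)) \<inter> space borel)"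
    by (auto simp: dyadic_cell_def)
  also have "\<dots> \<in> sets borel" by measurable
  finally show ?thesis .
qed

lemma convex_dyadic_cell: "convex (dyadic_cell u x)"
proof -
  have c: "convex (dyadic_interval j k)" for j k by (simp add: dyadic_interval_def)
  show ?thesis unfolding convex_def
    using c[unfolded convex_def] by (auto simp: dyadic_cell_def)
qed

lemma emeasure_dyadic_cell:
  fixes x :: "real ^ 'd::finite"
  shows "emeasure lborel (dyadic_cell u x) = ennreal (1 / 2 ^ (\<Sum>l\<in>UNIV. u l))"
proof -
  obtain a b where ab: "box a b \<subseteq> dyadic_cell u x" "dyadic_cell u x \<subseteq> cbox a b" "\<And>l. b $ l - a $ l = 1 / 2 ^ u l"
    using dyadic_cell_sandwich[of u x] by metis
  have le: "a $ l \<le> b $ l" for l using ab(3)[of l] by (smt (verit) zero_le_divide_1_iff zero_le_power)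
  then have le': "\<And>i. i \<in> Basis \<Longrightarrow> a \<bullet> i \<le> b \<bullet> i" by (auto simp: Basis_vec_def inner_axis)
  have "emeasure lborel (cbox a b) = ennreal (\<Prod>l\<in>UNIV. b $ l - a $ l)"
    using content_cbox_cart[of a b] le le' interval_ne_empty_cart(1)[of a b]
    by (simp add: emeasure_lborel_cbox_eq content_cbox)
  also have "(\<Prod>l\<in>UNIV. b $ l - a $ l) = 1 / 2 ^ (\<Sum>l\<in>UNIV. u l)"
    by (simp add: ab(3) prod_dividef power_sum)
  finally have c: "emeasure lborel (cbox a b) = ennreal (1 / 2 ^ (\<Sum>l\<in>UNIV. u l))" .
  moreover have "emeasure lborel (box a b) = emeasure lborel (cbox a b)"
    using le' by simp
  ultimately show ?thesis
    using emeasure_mono[OF ab(1), of lborel] emeasure_mono[OF ab(2), of lborel] by (auto intro: antisym)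
qed

lemma disjoint_dyadic_cells:
  assumes "K \<in> dyadic_rectangles_of_level u" "K' \<in> dyadic_rectangles_of_level u" "K \<noteq> K'"
  shows "K \<inter> K' = {}"
  using assms unfolding dyadic_rectangles_of_level_eq by (metis IntE dyadic_cell_eq equals0I imageE)

lemma emeasure_Union_dyadic_cells:
  assumes "F \<subseteq> dyadic_rectangles_of_level u"
  shows "emeasure lborel (\<Union>F) = ennreal (real (card F) / 2 ^ (\<Sum>l\<in>UNIV. u l))"
proof -
  have fin: "finite F" using assms finite_dyadic_rectangles_of_level finite_subset by blast
  have "emeasure lborel (\<Union>K\<in>F. K) = (\<Sum>K\<in>F. emeasure lborel K)"
  proof (rule sum_emeasure[symmetric, OF _ _ fin])
    show "(\<lambda>K. K) ` F \<subseteq> sets lborel" using assms by (auto simp: dyadic_rectangles_of_level_eq)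
    show "disjoint_family_on (\<lambda>K. K) F"
      using assms disjoint_dyadic_cells unfolding disjoint_family_on_def by blast
  qed
  also have "\<dots> = (\<Sum>K\<in>F. ennreal (1 / 2 ^ (\<Sum>l\<in>UNIV. u l)))"
    by (rule sum.cong) (use assms in \<open>auto simp: dyadic_rectangles_of_level_eq emeasure_dyadic_cell\<close>)
  also have "\<dots> = ennreal (real (card F) / 2 ^ (\<Sum>l\<in>UNIV. u l))"
    by (subst sum_ennreal) auto
  finally show ?thesis by simp
qed

lemma emeasure_unit_cube: "emeasure lborel (unit_cube :: (real ^ 'd::finite) set) = 1"
proof -
  have "dyadic_cell (\<lambda>_. 0) (0 :: real ^ 'd) = unit_cube"
    by (auto simp: dyadic_cell_def dyadic_interval_def dyadic_index_def mem_unit_cube)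
  then show ?thesis using emeasure_dyadic_cell[of "\<lambda>_. 0" "0 :: real ^ 'd"] by simp
qed

text \<open>Counting by volume: cells of one level are disjoint and of equal measure, so an
  inclusion of unions compares numbers of cells. It later bounds the number of children by the
  number of parents.\<close>

lemma card_le_of_Union_subset:
  assumes "F \<subseteq> dyadic_rectangles_of_level u" "G \<subseteq> dyadic_rectangles_of_level v" "\<Union>F \<subseteq> \<Union>G"
  shows "real (card F) \<le> 2 ^ (\<Sum>l\<in>UNIV. u l) / 2 ^ (\<Sum>l\<in>UNIV. v l) * real (card G)"
proof -
  have "finite G" using assms(2) finite_dyadic_rectangles_of_level finite_subset by blast
  then have "\<Union>G \<in> sets lborel" using assms(2) by (intro sets.finite_Union) (auto simp: dyadic_rectangles_of_level_eq)
  from emeasure_mono[OF assms(3) this] show ?thesis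
    unfolding emeasure_Union_dyadic_cells[OF assms(1)] emeasure_Union_dyadic_cells[OF assms(2)]
    by (simp add: field_simps)
qed

lemma card_dyadic_rectangles_of_level_le:
  "real (card (dyadic_rectangles_of_level (u :: 'd::finite \<Rightarrow> nat))) \<le> 2 ^ (\<Sum>l\<in>UNIV. u l)"
proof -
  have "\<Union>(dyadic_rectangles_of_level u) \<subseteq> unit_cube"
    using dyadic_cell_subset by (force simp: dyadic_rectangles_of_level_eq)
  then have "emeasure lborel (\<Union>(dyadic_rectangles_of_level u)) \<le> emeasure lborel (unit_cube :: (real ^ 'd) set)"
    by (rule emeasure_mono) simp
  then have "ennreal (real (card (dyadic_rectangles_of_level u)) / 2 ^ (\<Sum>l\<in>UNIV. u l)) \<le> ennreal 1"
    unfolding emeasure_Union_dyadic_cells[OF order_refl] by (simp add: emeasure_unit_cube)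
  then show ?thesis by (simp add: field_simps del: of_nat_le_iff)
qed

section \<open>Partitions obtained by stopping\<close>

lemma geometric_tail_sum_le:
  fixes \<rho> :: real
  assumes "0 < \<rho>" "\<rho> < 1" "J \<le> a"
  shows "(\<Sum>i\<in>{a..<N}. \<rho> ^ (i - J)) \<le> \<rho> ^ (a - J) / (1 - \<rho>)"
proof (cases "a \<le> N")
  case True
  then have "(\<Sum>i\<in>{a..<N}. \<rho> ^ (i - J)) * (1 - \<rho>) = \<rho> ^ (a - J) - \<rho> ^ (N - J)"
  proof (induction rule: dec_induct)
    case (step n)
    have "(\<Sum>i\<in>{a..<Suc n}. \<rho> ^ (i - J)) * (1 - \<rho>)
        = (\<Sum>i\<in>{a..<n}. \<rho> ^ (i - J)) * (1 - \<rho>) + \<rho> ^ (n - J) * (1 - \<rho>)"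
      using step(1) by (simp add: distrib_right)
    also have "\<dots> = \<rho> ^ (a - J) - \<rho> ^ (Suc n - J)"
      unfolding step.IH using assms(3) step(1) by (simp add: Suc_diff_le algebra_simps)
    finally show ?case .
  qed simp
  also have "\<dots> \<le> \<rho> ^ (a - J)" using assms by simp
  finally show ?thesis using assms by (simp add: pos_le_divide_eq)
qed (use assms in simp)

text \<open>\<open>X i\<close> is the bad set of level \<open>i\<close>. A cell stopped at level
  \<open>Suc j\<close> has a parent that still meets a later bad set. Such parents are ancestors of
  bad cells, so their number is at most a geometric tail, and each has at most
  \<open>2 ^ CARD('d)\<close> children. Summing over \<open>i\<close> and then over \<open>j\<close>
  produces the two factors \<open>1 - \<rho>\<close>.\<close>

lemma adaptive_dyadic_partition:
  fixes L :: "nat \<Rightarrow> 'd::finite \<Rightarrow> nat" and X :: "nat \<Rightarrow> (real ^ 'd) set" and \<rho> b :: real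
  assumes L: "\<And>j. L j \<le> L (Suc j)" "\<And>j l. L (Suc j) l \<le> Suc (L j l)"
    and \<rho>: "0 < \<rho>" "\<rho> < 1"
    and X: "\<And>i. J < i \<Longrightarrow>
      real (card {K \<in> dyadic_rectangles_of_level (L i). K \<inter> X i \<noteq> {}}) \<le> b * \<rho> ^ (i - J)"
  obtains m \<tau> N where "dyadic_partition m"
    "real (card m) \<le> 2 ^ (\<Sum>l\<in>UNIV. L J l) + 2 ^ CARD('d) * (b * \<rho> / (1 - \<rho>)\<^sup>2)"
    "\<And>K. K \<in> m \<Longrightarrow> \<exists>j. K \<in> dyadic_rectangles_of_level (L j) \<and> (\<forall>x\<in>K. \<tau> x = j)"
    "\<And>x. x \<in> unit_cube \<Longrightarrow> J \<le> \<tau> x"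
    "\<And>x. x \<in> unit_cube \<Longrightarrow> \<tau> x \<le> N"
    "\<And>x i. x \<in> unit_cube \<Longrightarrow> \<tau> x < i \<Longrightarrow> x \<notin> X i"
proof -
  define D where "D j = dyadic_rectangles_of_level (L j)" for j
  define c where "c j x = dyadic_cell (L j) x" for j x
  define Y where "Y i = {K \<in> D i. K \<inter> X i \<noteq> {}}" for i
  \<comment> \<open>Only strictly later levels count: in the application the increments up to the
    current level are already contained in the approximant used on the cell.\<close>
  define good where "good j x \<longleftrightarrow> (\<forall>i>j. c j x \<inter> X i = {})" for j x
  define \<tau> where "\<tau> x = (LEAST j. J \<le> j \<and> good j x)" for x
  have D: "D j = c j ` unit_cube" for j by (simp add: D_def c_def[abs_def] dyadic_rectangles_of_level_eq)
  have finD: "finite (D j)" for j by (simp add: D_def finite_dyadic_rectangles_of_level)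
  have self: "x \<in> c j x" if "x \<in> unit_cube" for j x using that by (simp add: c_def dyadic_cell_self)
  have sub: "c j x \<subseteq> unit_cube" if "x \<in> unit_cube" for j x using that by (simp add: c_def dyadic_cell_subset)
  have eq: "c j y = c j x" if "x \<in> unit_cube" "y \<in> c j x" for j x y
    using that by (simp add: c_def dyadic_cell_eq)
  have Lmono: "L i \<le> L j" if "i \<le> j" for i j using lift_Suc_mono_le[of L, OF L(1) that] .
  have mono: "c j x \<subseteq> c i x" if "x \<in> unit_cube" "i \<le> j" for i j x
    using that Lmono by (simp add: c_def dyadic_cell_mono)
  have Xcard: "real (card (Y i)) \<le> b * \<rho> ^ (i - J)" if "J < i" for i using X[OF that] by (simp add: Y_def D_def)
  have "0 \<le> b * \<rho>" using Xcard[of "Suc J"] order_trans[OF of_nat_0_le_iff] by fastforce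
  then have b0: "0 \<le> b" using \<rho> by (simp add: zero_le_mult_iff)
  have "(\<lambda>n. b * \<rho> ^ n) \<longlonglongrightarrow> b * 0" using \<rho> by (intro tendsto_intros LIMSEQ_power_zero) auto
  then have "eventually (\<lambda>n. b * \<rho> ^ n < 1) sequentially" by (rule order_tendstoD) simp
  then obtain n0 where n0: "\<And>n. n \<ge> n0 \<Longrightarrow> b * \<rho> ^ n < 1" by (auto simp: eventually_sequentially)
  \<comment> \<open>Beyond \<open>N\<close> the bound on the number of bad cells is below 1, so
    there are none. Stopping therefore occurs at \<open>N\<close> at the latest, which makes the
    partition finite.\<close>
  define N where "N = J + n0"
  have Xempty: "X i \<inter> unit_cube = {}" if "N < i" for i
  proof -
    have "real (card (Y i)) < 1" 
      by (rule le_less_trans[OF Xcard n0]) (use that in \<open>simp_all add: N_def\<close>)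
    then have "Y i = {}" using finD by (simp add: Y_def)
    then show ?thesis using self by (auto simp: Y_def D)
  qed
  have goodN: "good N x" if "x \<in> unit_cube" for x
    using sub[OF that] Xempty by (fastforce simp: good_def)
  have \<tau>: "J \<le> \<tau> x" "good (\<tau> x) x" "\<tau> x \<le> N" if "x \<in> unit_cube" for x
  proof -
    have w: "J \<le> N \<and> good N x" using goodN[OF that] by (simp add: N_def)
    from LeastI[of "\<lambda>j. J \<le> j \<and> good j x", OF w] show "J \<le> \<tau> x" "good (\<tau> x) x" by (auto simp: \<tau>_def)
    from Least_le[of "\<lambda>j. J \<le> j \<and> good j x", OF w] show "\<tau> x \<le> N" by (simp add: \<tau>_def)
  qed
  have \<tau>_le: "\<tau> x \<le> j" if "J \<le> j" "good j x" for x j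
    unfolding \<tau>_def by (rule Least_le) (use that in simp)
  \<comment> \<open>Up to level \<open>\<tau> x\<close> the cells of \<open>x\<close> and
    \<open>y\<close> coincide, so the same levels are good for both points and neither stops before
    the other.\<close>
  have \<tau>_eq: "\<tau> y = \<tau> x" if x: "x \<in> unit_cube" and y: "y \<in> c (\<tau> x) x" for x y
  proof -
    have yc: "y \<in> unit_cube" using sub[OF x] y by blast
    have same: "c j y = c j x" if "j \<le> \<tau> x" for j using eq[OF x] mono[OF x that] y by blast
    have "good (\<tau> x) y" using \<tau>(2)[OF x] same[of "\<tau> x"] by (simp add: good_def)
    then have le: "\<tau> y \<le> \<tau> x" using \<tau>_le \<tau>(1)[OF x] by blast
    then have "good (\<tau> y) x" using \<tau>(2)[OF yc] same by (simp add: good_def)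
    then have "\<tau> x \<le> \<tau> y" using \<tau>_le \<tau>(1)[OF yc] by blast
    with le show ?thesis by simp
  qed
  define m where "m = (\<lambda>x. c (\<tau> x) x) ` unit_cube"
  have m_fin: "finite m"
  proof (rule finite_subset)
    show "m \<subseteq> (\<Union>j\<in>{..N}. D j)" using \<tau>(3) by (fastforce simp: m_def D)
    show "finite (\<Union>j\<in>{..N}. D j)" using finD by blast
  qed
  have part: "partition_on unit_cube m"
  proof (rule partition_onI)
    show "\<Union>m = unit_cube" using self sub by (fastforce simp: m_def)
    show "{} \<notin> m" using self by (fastforce simp: m_def)
    show "disjnt K K'" if "K \<in> m" "K' \<in> m" "K \<noteq> K'" for K K'
    proof -
      obtain x x' where x: "x \<in> unit_cube" "K = c (\<tau> x) x" and x': "x' \<in> unit_cube" "K' = c (\<tau> x') x'"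
        using \<open>K \<in> m\<close> \<open>K' \<in> m\<close> by (auto simp: m_def)
      have False if "y \<in> K" "y \<in> K'" for y
        using that x x' \<tau>_eq[of x y] \<tau>_eq[of x' y] eq[of x y "\<tau> x"] eq[of x' y "\<tau> x'"] \<open>K \<noteq> K'\<close> by simp
      then show ?thesis by (auto simp: disjnt_def)
    qed
  qed
  have rect: "m \<subseteq> dyadic_rectangles" using D by (fastforce simp: m_def dyadic_rectangles_def D_def)
  \<comment> \<open>\<open>B j\<close> collects the cells of level \<open>j\<close> that are not
    good. \<open>m1 j\<close> records the value of \<open>\<tau>\<close> because consecutive levels
    of \<open>L\<close> may coincide, and then the same set belongs to several
    \<open>D j\<close>.\<close>
  define B where "B j = {K \<in> D j. \<exists>i>j. K \<inter> X i \<noteq> {}}" for j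
  define m1 where "m1 j = {K \<in> m \<inter> D (Suc j). \<exists>x\<in>K. \<tau> x = Suc j}" for j
  have cardB: "real (card (B j)) \<le> b * (\<rho> ^ (Suc j - J) / (1 - \<rho>))" if "J \<le> j" for j
  proof -
    \<comment> \<open>\<open>F\<close> sends a finer cell to its ancestor of level \<open>j\<close>,
      found through an arbitrary point of it; every cell in \<open>B j\<close> is the ancestor of a
      bad cell.\<close>
    define F where "F K = c j (SOME x. x \<in> K)" for K
    have "B j \<subseteq> (\<Union>i\<in>{Suc j..<Suc N}. F ` Y i)"
    proof
      fix K assume "K \<in> B j"
      then obtain i z where K: "K \<in> D j" and i: "i > j" and z: "z \<in> K" "z \<in> X i" by (auto simp: B_def)
      have zc: "z \<in> unit_cube" using K z(1) sub by (auto simp: D)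
      have Kz: "K = c j z" using K z(1) eq by (auto simp: D)
      have iN: "i < Suc N" using Xempty[of i] z(2) zc by force
      have "c i z \<in> Y i" using zc z(2) self[OF zc] by (auto simp: Y_def D)
      moreover have "(SOME x. x \<in> c i z) \<in> c i z" using self[OF zc] by (rule someI)
      then have "F (c i z) = K" using mono[OF zc, of j i] i eq[OF zc, of _ j] by (auto simp: F_def Kz)
      ultimately show "K \<in> (\<Union>i\<in>{Suc j..<Suc N}. F ` Y i)" using i iN by force
    qed
    then have "card (B j) \<le> card (\<Union>i\<in>{Suc j..<Suc N}. F ` Y i)"
      using finD by (intro card_mono) (auto simp: Y_def)
    also have "\<dots> \<le> (\<Sum>i\<in>{Suc j..<Suc N}. card (F ` Y i))" by (rule card_UN_le) simp
    also have "\<dots> \<le> (\<Sum>i\<in>{Suc j..<Suc N}. card (Y i))"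
      using finD by (intro sum_mono card_image_le) (simp add: Y_def)
    finally have "real (card (B j)) \<le> (\<Sum>i\<in>{Suc j..<Suc N}. real (card (Y i)))"
      by (metis of_nat_le_iff of_nat_sum)
    also have "\<dots> \<le> (\<Sum>i\<in>{Suc j..<Suc N}. b * \<rho> ^ (i - J))"
      using that by (intro sum_mono Xcard) auto
    also have "\<dots> = b * (\<Sum>i\<in>{Suc j..<Suc N}. \<rho> ^ (i - J))" by (rule sum_distrib_left[symmetric])
    also have "\<dots> \<le> b * (\<rho> ^ (Suc j - J) / (1 - \<rho>))"
      using that \<rho> b0 by (intro mult_left_mono geometric_tail_sum_le) auto
    finally show ?thesis .
  qed
  have cardm1: "real (card (m1 j)) \<le> 2 ^ CARD('d) * real (card (B j))" if "J \<le> j" for j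
  proof -
    \<comment> \<open>A point stopped at \<open>Suc j\<close> was not good at \<open>j\<close>,
      since \<open>J \<le> j\<close>; hence its cell of level \<open>j\<close> lies in
      \<open>B j\<close>. The inclusion of unions is what the volume count takes as input.\<close>
    have "\<Union>(m1 j) \<subseteq> \<Union>(B j)"
    proof
      fix y assume "y \<in> \<Union>(m1 j)"
      then obtain K x where K: "K \<in> D (Suc j)" "x \<in> K" "\<tau> x = Suc j" "y \<in> K" by (auto simp: m1_def)
      have x: "x \<in> unit_cube" using K sub by (auto simp: D)
      have "K = c (Suc j) x" using K eq by (auto simp: D)
      then have y: "y \<in> c j x" using mono[OF x, of j "Suc j"] K by auto
      have "\<not> good j x" using \<tau>_le[of j x] that K(3) by auto
      then have "c j x \<in> B j" using x by (auto simp: good_def B_def D)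
      with y show "y \<in> \<Union>(B j)" by blast
    qed
    then have "real (card (m1 j)) \<le> 2 ^ (\<Sum>l\<in>UNIV. L (Suc j) l) / 2 ^ (\<Sum>l\<in>UNIV. L j l) * real (card (B j))"
      by (intro card_le_of_Union_subset) (auto simp: m1_def B_def D_def)
    also have "\<dots> \<le> 2 ^ CARD('d) * real (card (B j))"
    proof (rule mult_right_mono)
      have "(\<Sum>l\<in>UNIV. L (Suc j) l) \<le> (\<Sum>l\<in>UNIV. Suc (L j l))" by (rule sum_mono) (rule L(2))
      also have "\<dots> = CARD('d) + (\<Sum>l\<in>UNIV. L j l)" by (simp add: sum.distrib[symmetric] sum_Suc)
      finally have "(2::real) ^ (\<Sum>l\<in>UNIV. L (Suc j) l) \<le> 2 ^ (CARD('d) + (\<Sum>l\<in>UNIV. L j l))"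
        by (rule power_increasing) simp
      then show "2 ^ (\<Sum>l\<in>UNIV. L (Suc j) l) / 2 ^ (\<Sum>l\<in>UNIV. L j l) \<le> (2::real) ^ CARD('d)"
        by (simp add: power_add pos_divide_le_eq)
    qed simp
    finally show ?thesis .
  qed
  have "m \<subseteq> D J \<union> (\<Union>j\<in>{J..<N}. m1 j)"
  proof
    fix K assume K: "K \<in> m"
    then obtain x where x: "x \<in> unit_cube" "K = c (\<tau> x) x" by (auto simp: m_def)
    show "K \<in> D J \<union> (\<Union>j\<in>{J..<N}. m1 j)"
    proof (cases "\<tau> x = J")
      case True
      then show ?thesis using x by (auto simp: D)
    next
      case False
      then obtain j where j: "\<tau> x = Suc j" "j \<ge> J" using \<tau>(1)[OF x(1)] by (cases "\<tau> x") auto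
      then have "K \<in> m1 j" using K x self[OF x(1)] by (auto simp: m1_def D)
      then show ?thesis using j \<tau>(3)[OF x(1)] by auto
    qed
  qed
  then have "card m \<le> card (D J \<union> (\<Union>j\<in>{J..<N}. m1 j))"
    using finD m_fin by (intro card_mono) (auto simp: m1_def)
  also have "\<dots> \<le> card (D J) + card (\<Union>j\<in>{J..<N}. m1 j)" by (rule card_Un_le)
  also have "card (\<Union>j\<in>{J..<N}. m1 j) \<le> (\<Sum>j\<in>{J..<N}. card (m1 j))" by (rule card_UN_le) simp
  finally have "real (card m) \<le> real (card (D J) + (\<Sum>j\<in>{J..<N}. card (m1 j)))"
    by (simp only: of_nat_le_iff add_left_mono)
  also have "\<dots> = real (card (D J)) + (\<Sum>j\<in>{J..<N}. real (card (m1 j)))" by simp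
  also have "\<dots> \<le> 2 ^ (\<Sum>l\<in>UNIV. L J l) + (\<Sum>j\<in>{J..<N}. 2 ^ CARD('d) * (b * \<rho> / (1 - \<rho>)) * \<rho> ^ (j - J))"
  proof (intro add_mono sum_mono)
    show "real (card (D J)) \<le> 2 ^ (\<Sum>l\<in>UNIV. L J l)" unfolding D_def by (rule card_dyadic_rectangles_of_level_le)
    fix j assume j: "j \<in> {J..<N}"
    have "real (card (m1 j)) \<le> 2 ^ CARD('d) * real (card (B j))" using cardm1 j by simp
    also have "\<dots> \<le> 2 ^ CARD('d) * (b * (\<rho> ^ (Suc j - J) / (1 - \<rho>)))"
      using cardB j by (intro mult_left_mono) auto
    finally show "real (card (m1 j)) \<le> 2 ^ CARD('d) * (b * \<rho> / (1 - \<rho>)) * \<rho> ^ (j - J)"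
      using j by (simp add: Suc_diff_le mult_ac)
  qed
  also have "(\<Sum>j\<in>{J..<N}. 2 ^ CARD('d) * (b * \<rho> / (1 - \<rho>)) * \<rho> ^ (j - J))
      = 2 ^ CARD('d) * (b * \<rho> / (1 - \<rho>)) * (\<Sum>j\<in>{J..<N}. \<rho> ^ (j - J))" by (simp add: sum_distrib_left)
  also have "\<dots> \<le> 2 ^ CARD('d) * (b * \<rho> / (1 - \<rho>)) * (\<rho> ^ (J - J) / (1 - \<rho>))"
    using \<rho> b0 by (intro mult_left_mono geometric_tail_sum_le) auto
  also have "\<dots> = 2 ^ CARD('d) * (b * \<rho> / (1 - \<rho>)\<^sup>2)" by (simp add: power2_eq_square)
  finally have card: "real (card m) \<le> 2 ^ (\<Sum>l\<in>UNIV. L J l) + 2 ^ CARD('d) * (b * \<rho> / (1 - \<rho>)\<^sup>2)" by simp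
  show ?thesis
  proof (rule that[of m \<tau> N])
    show "dyadic_partition m" using m_fin rect part by (simp add: dyadic_partition_def)
    show "\<exists>j. K \<in> dyadic_rectangles_of_level (L j) \<and> (\<forall>x\<in>K. \<tau> x = j)" if "K \<in> m" for K
      using that \<tau>_eq D by (fastforce simp: m_def D_def)
    show "x \<notin> X i" if "x \<in> unit_cube" "\<tau> x < i" for x i
      using \<tau>(2)[OF that(1)] that self[OF that(1)] by (auto simp: good_def)
  qed (use \<tau> card in auto)
qed

section \<open>Lebesgue quasi-norms\<close>

text \<open>Bounds for finite exponents are moved to the integral of the \<open>p\<close>-th power
  by this equivalence, which treats the quasi-norms with \<open>p < 1\<close> in the same way as the
  norms.\<close>

lemma Lp_norm_le_iff:
  fixes f :: "real ^ 'd::finite \<Rightarrow> real"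
  assumes "0 < p" "0 \<le> A"
  shows "Lp_norm (ereal p) f \<le> ennreal A \<longleftrightarrow>
    (\<integral>\<^sup>+x. ennreal (\<bar>f x\<bar> powr p) \<partial>lebesgue_on unit_cube) \<le> ennreal (A powr p)"
proof (cases "(\<integral>\<^sup>+x. ennreal (\<bar>f x\<bar> powr p) \<partial>lebesgue_on unit_cube)")
  case (real v)
  have "v powr (1 / p) \<le> A \<longleftrightarrow> v \<le> A powr p"
  proof
    assume "v powr (1 / p) \<le> A"
    then have "(v powr (1 / p)) powr p \<le> A powr p" using assms by (intro powr_mono2) auto
    then show "v \<le> A powr p" using assms real by (simp add: powr_powr)
  next
    assume "v \<le> A powr p"
    then have "v powr (1 / p) \<le> (A powr p) powr (1 / p)" using assms real by (intro powr_mono2) auto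
    then show "v powr (1 / p) \<le> A" using assms by (simp add: powr_powr)
  qed
  then show ?thesis using real assms by (simp add: Lp_norm_def ennreal_powr_def)
next
  case top
  then show ?thesis by (simp add: Lp_norm_def ennreal_powr_def top_unique)
qed

lemma Lp_norm_infinity_le:
  fixes f :: "real ^ 'd::finite \<Rightarrow> real"
  assumes "f \<in> borel_measurable (lebesgue_on unit_cube)" "AE x in lebesgue_on unit_cube. \<bar>f x\<bar> \<le> A"
  shows "Lp_norm \<infinity> f \<le> ennreal A"
  unfolding Lp_norm_def using assms by (auto intro!: esssup_I elim: eventually_mono simp: ennreal_leI)

lemma AE_le_Lp_norm_infinity:
  fixes f :: "real ^ 'd::finite \<Rightarrow> real"
  assumes "0 \<le> A" "Lp_norm \<infinity> f \<le> ennreal A"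
  shows "AE x in lebesgue_on unit_cube. \<bar>f x\<bar> \<le> A"
proof -
  have "AE x in lebesgue_on unit_cube. ennreal \<bar>f x\<bar> \<le> esssup (lebesgue_on unit_cube) (\<lambda>x. ennreal \<bar>f x\<bar>)"
    by (rule esssup_AE)
  then show ?thesis using assms unfolding Lp_norm_def
    by (auto elim!: eventually_mono dest: order_trans simp: ennreal_le_iff)
qed

text \<open>For finite \<open>q = r\<close>, the pointwise bound \<open>\<bar>h x\<bar> powr r \<le>
  M powr (r - p) * \<bar>h x\<bar> powr p\<close> is integrated. The weight \<open>\<theta>\<close>
  is 1 - p/q; for infinite \<open>q\<close> it is 1, since \<open>1 / q\<close> is then 0, and the
  bound reduces to \<open>M\<close>.\<close>

lemma Lp_norm_interpolation:
  fixes h :: "real ^ 'd::finite \<Rightarrow> real" and q :: ereal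
  assumes h: "h \<in> borel_measurable (lebesgue_on unit_cube)"
    and p: "0 < p" "ereal p < q" and M: "0 < M" "0 < A"
    and le: "\<And>x. x \<in> unit_cube \<Longrightarrow> \<bar>h x\<bar> \<le> M" "Lp_norm (ereal p) h \<le> ennreal A"
    and \<theta>: "\<theta> = p * (1 / p - real_of_ereal (1 / q))"
  shows "Lp_norm q h \<le> ennreal (M powr \<theta> * A powr (1 - \<theta>))"
proof (cases q)
  case (real r)
  then have r: "0 < r" "p < r" using p by auto
  have inv: "real_of_ereal (1 / q) = 1 / r" using real r by (simp add: one_ereal_def)
  have e: "\<theta> * r = r - p" "(1 - \<theta>) * r = p" using r p by (simp_all add: \<theta> inv field_simps)
  have "(\<integral>\<^sup>+x. ennreal (\<bar>h x\<bar> powr r) \<partial>lebesgue_on unit_cube)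
      \<le> (\<integral>\<^sup>+x. ennreal (M powr (r - p)) * ennreal (\<bar>h x\<bar> powr p) \<partial>lebesgue_on unit_cube)"
  proof (rule nn_integral_mono)
    fix x :: "real ^ 'd" assume "x \<in> space (lebesgue_on unit_cube)"
    then have "\<bar>h x\<bar> \<le> M" using le(1) by simp
    then have "\<bar>h x\<bar> powr (r - p) * \<bar>h x\<bar> powr p \<le> M powr (r - p) * \<bar>h x\<bar> powr p"
      using r by (intro mult_right_mono powr_mono2) auto
    moreover have "\<bar>h x\<bar> powr (r - p) * \<bar>h x\<bar> powr p = \<bar>h x\<bar> powr r" by (simp add: powr_add[symmetric])
    ultimately show "ennreal (\<bar>h x\<bar> powr r) \<le> ennreal (M powr (r - p)) * ennreal (\<bar>h x\<bar> powr p)"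
      by (simp add: ennreal_mult[symmetric] ennreal_leI)
  qed
  also have "\<dots> = ennreal (M powr (r - p)) * (\<integral>\<^sup>+x. ennreal (\<bar>h x\<bar> powr p) \<partial>lebesgue_on unit_cube)"
    using h by (intro nn_integral_cmult) measurable
  also have "\<dots> \<le> ennreal (M powr (r - p)) * ennreal (A powr p)"
    using le(2) p M by (intro mult_left_mono) (simp_all add: Lp_norm_le_iff less_imp_le)
  also have "\<dots> = ennreal ((M powr \<theta> * A powr (1 - \<theta>)) powr r)"
    using M by (simp add: ennreal_mult[symmetric] powr_mult powr_powr e)
  finally show ?thesis using r M unfolding real by (subst Lp_norm_le_iff) auto
next
  case PInf
  then show ?thesis using p M h le(1) by (auto intro!: Lp_norm_infinity_le AE_I2 simp: \<theta>)
qed (use p in auto)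

text \<open>A stand-in for the triangle inequality at every exponent \<open>r > 0\<close>: the
  \<open>r\<close>-th root \<open>z\<close> of the weighted sum of powers dominates each
  \<open>a n / w ^ n\<close>, so the series of the \<open>a n\<close> is at most \<open>z\<close>
  times a geometric series.\<close>

lemma weighted_series_powr_le:
  fixes a :: "nat \<Rightarrow> real"
  assumes r: "0 < r" and w: "0 < w" "w < 1" and a: "\<And>n. 0 \<le> a n" and y: "0 \<le> y"
    and le: "ennreal y \<le> (\<Sum>n. ennreal (a n))"
  shows "ennreal (y powr r) \<le> ennreal ((1 / (1 - w)) powr r) * (\<Sum>n. ennreal ((a n / w ^ n) powr r))"
proof (cases "(\<Sum>n. ennreal ((a n / w ^ n) powr r))")
  case (real v)
  define z where "z = v powr (1 / r)"
  have z: "0 \<le> z" "z powr r = v" using r real(1) by (simp_all add: z_def powr_powr)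
  have "a n \<le> z * w ^ n" for n
  proof -
    have "sum f {n} \<le> suminf f" for f :: "nat \<Rightarrow> ennreal" by (rule sum_le_suminf) auto
    from this[of "\<lambda>n. ennreal ((a n / w ^ n) powr r)"] have "ennreal ((a n / w ^ n) powr r) \<le> ennreal v"
      unfolding real(2) by (simp only: sum.insert sum.empty finite.emptyI empty_iff not_False_eq_True add_0_right)
    then have "(a n / w ^ n) powr r \<le> v" using real(1) by (simp only: ennreal_le_iff)
    then have "((a n / w ^ n) powr r) powr (1 / r) \<le> z"
      unfolding z_def using r by (intro powr_mono2) simp_all
    moreover have "(b powr r) powr (1 / r) = b" if "0 \<le> b" for b using that r by (simp add: powr_powr)
    from this[of "a n / w ^ n"] have "((a n / w ^ n) powr r) powr (1 / r) = a n / w ^ n" using a w by simp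
    ultimately have "a n / w ^ n \<le> z" by simp
    then show ?thesis using w by (simp only: pos_divide_le_eq zero_less_power)
  qed
  then have "(\<Sum>n. ennreal (a n)) \<le> (\<Sum>n. ennreal (z * w ^ n))"
    by (intro suminf_le) (auto intro: ennreal_leI)
  also have "\<dots> = ennreal (z * (1 / (1 - w)))"
    using w z(1) by (intro suminf_ennreal_eq sums_mult geometric_sums) auto
  finally have "ennreal y \<le> ennreal (z * (1 / (1 - w)))" using le by (rule order_trans[rotated])
  then have "y \<le> z * (1 / (1 - w))" using w z(1) by (subst (asm) ennreal_le_iff) auto
  then have "y powr r \<le> (z * (1 / (1 - w))) powr r"
    using r y by (intro powr_mono2) auto
  also have "\<dots> = (1 / (1 - w)) powr r * v" using w z by (subst powr_mult) auto
  finally have "ennreal (y powr r) \<le> ennreal ((1 / (1 - w)) powr r * v)" by (rule ennreal_leI)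
  then show ?thesis unfolding real(2) using real(1) by (subst ennreal_mult[symmetric]) auto
next
  case top
  have "ennreal ((1 / (1 - w)) powr r) \<noteq> 0" using w by simp
  then show ?thesis unfolding top by (simp add: ennreal_mult_top)
qed

text \<open>A countable quasi-triangle inequality for terms with geometrically decaying norms. The
  constant is fixed before \<open>D\<close>, \<open>h\<close> and \<open>f\<close>, so it depends
  only on \<open>q\<close>, \<open>\<rho>\<close> and the dimension.\<close>

lemma Lp_norm_le_of_series:
  fixes q :: ereal and \<rho> :: real
  assumes q: "0 < q" and \<rho>: "0 < \<rho>" "\<rho> < 1"
  obtains C where "0 < C" "\<And>D (h :: nat \<Rightarrow> real ^ 'd::finite \<Rightarrow> real) f.
    0 \<le> D \<Longrightarrow> (\<And>n. h n \<in> borel_measurable (lebesgue_on unit_cube)) \<Longrightarrow>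
    f \<in> borel_measurable (lebesgue_on unit_cube) \<Longrightarrow>
    (\<And>n. Lp_norm q (h n) \<le> ennreal (D * \<rho> ^ n)) \<Longrightarrow>
    (AE x in lebesgue_on unit_cube. ennreal \<bar>f x\<bar> \<le> (\<Sum>n. ennreal \<bar>h n x\<bar>)) \<Longrightarrow>
    Lp_norm q f \<le> ennreal (C * D)"
proof (cases q)
  case (real r)
  then have r: "0 < r" using q by simp
  \<comment> \<open>The decay \<open>\<rho> ^ n\<close> is split into two factors
    \<open>w ^ n\<close>: one pays for the weight in \<open>weighted_series_powr_le\<close>, the
    other makes the series of \<open>r\<close>-th powers converge.\<close>
  define w where "w = sqrt \<rho>"
  have w: "0 < w" "w < 1" "w * w = \<rho>" using \<rho> by (simp_all add: w_def real_sqrt_lt_1_iff)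
  have wr: "0 < w powr r" "w powr r < 1" using w r powr_less_mono2[of r w 1] by simp_all
  define C where "C = 1 / (1 - w) * (1 / (1 - w powr r)) powr (1 / r)"
  have "0 < (1 / (1 - w powr r)) powr (1 / r)" unfolding powr_gt_zero using wr by simp
  moreover have "0 < 1 / (1 - w)" using w(2) by simp
  ultimately have C: "C > 0" unfolding C_def by (rule mult_pos_pos[rotated])
  show ?thesis
  proof (rule that[of C, OF C])
    fix D :: real and h :: "nat \<Rightarrow> real ^ 'd \<Rightarrow> real" and f :: "real ^ 'd \<Rightarrow> real"
    assume D: "0 \<le> D" and h[measurable]: "\<And>n. h n \<in> borel_measurable (lebesgue_on unit_cube)"
      and f: "f \<in> borel_measurable (lebesgue_on unit_cube)"
      and le: "\<And>n. Lp_norm q (h n) \<le> ennreal (D * \<rho> ^ n)"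
      and AE: "AE x in lebesgue_on unit_cube. ennreal \<bar>f x\<bar> \<le> (\<Sum>n. ennreal \<bar>h n x\<bar>)"
    have pt: "ennreal (\<bar>f x\<bar> powr r) \<le> ennreal ((1 / (1 - w)) powr r) * (\<Sum>n. ennreal ((\<bar>h n x\<bar> / w ^ n) powr r))"
      if fx: "ennreal \<bar>f x\<bar> \<le> (\<Sum>n. ennreal \<bar>h n x\<bar>)" for x
      using weighted_series_powr_le[OF r w(1,2) abs_ge_zero abs_ge_zero fx] .
    have "(\<integral>\<^sup>+x. ennreal (\<bar>f x\<bar> powr r) \<partial>lebesgue_on unit_cube)
        \<le> (\<integral>\<^sup>+x. ennreal ((1 / (1 - w)) powr r) * (\<Sum>n. ennreal ((\<bar>h n x\<bar> / w ^ n) powr r)) \<partial>lebesgue_on unit_cube)"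
      by (rule nn_integral_mono_AE) (use AE in eventually_elim, rule pt)
    also have "\<dots> = ennreal ((1 / (1 - w)) powr r) * (\<Sum>n. \<integral>\<^sup>+x. ennreal ((\<bar>h n x\<bar> / w ^ n) powr r) \<partial>lebesgue_on unit_cube)"
      by (subst nn_integral_cmult) (simp_all add: nn_integral_suminf)
    also have "\<dots> \<le> ennreal ((1 / (1 - w)) powr r) * (\<Sum>n. ennreal (D powr r * (w powr r) ^ n))"
    proof (intro mult_left_mono suminf_le)
      fix n
      have wn: "(w ^ n) powr r = (w powr r) ^ n" using w by (induction n) (simp_all add: powr_mult)
      have "(\<integral>\<^sup>+x. ennreal ((\<bar>h n x\<bar> / w ^ n) powr r) \<partial>lebesgue_on unit_cube)
        = (\<integral>\<^sup>+x. ennreal (1 / (w powr r) ^ n) * ennreal (\<bar>h n x\<bar> powr r) \<partial>lebesgue_on unit_cube)"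
        using w by (intro nn_integral_cong) (simp add: ennreal_mult[symmetric] powr_divide wn)
      also have "\<dots> = ennreal (1 / (w powr r) ^ n) * (\<integral>\<^sup>+x. ennreal (\<bar>h n x\<bar> powr r) \<partial>lebesgue_on unit_cube)"
        by (rule nn_integral_cmult) measurable
      also have "\<dots> \<le> ennreal (1 / (w powr r) ^ n) * ennreal ((D * \<rho> ^ n) powr r)"
        using le[of n] r D \<rho> unfolding real by (intro mult_left_mono) (simp_all add: Lp_norm_le_iff)
      also have "\<dots> = ennreal (D powr r * (w powr r) ^ n)"
      proof -
        have "(D * \<rho> ^ n) powr r = D powr r * ((w powr r) ^ n * (w powr r) ^ n)"
          using w D by (simp add: powr_mult w(3)[symmetric] power_mult_distrib wn)
        then show ?thesis using w by (simp add: ennreal_mult[symmetric])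
      qed
      finally show "(\<integral>\<^sup>+x. ennreal ((\<bar>h n x\<bar> / w ^ n) powr r) \<partial>lebesgue_on unit_cube)
        \<le> ennreal (D powr r * (w powr r) ^ n)" .
    qed auto
    also have "(\<Sum>n. ennreal (D powr r * (w powr r) ^ n)) = ennreal (D powr r * (1 / (1 - w powr r)))"
      using wr by (intro suminf_ennreal_eq sums_mult geometric_sums) auto
    also have "ennreal ((1 / (1 - w)) powr r) * \<dots> = ennreal ((C * D) powr r)"
      using w wr D r by (simp add: ennreal_mult[symmetric] C_def powr_mult powr_divide powr_powr)
    finally show "Lp_norm q f \<le> ennreal (C * D)"
      unfolding real using r C D by (subst Lp_norm_le_iff) auto
  qed
next
  case PInf
  show ?thesis
  proof (rule that[of "1 / (1 - \<rho>)"])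
    fix D :: real and h :: "nat \<Rightarrow> real ^ 'd \<Rightarrow> real" and f :: "real ^ 'd \<Rightarrow> real"
    assume D: "0 \<le> D" and f: "f \<in> borel_measurable (lebesgue_on unit_cube)"
      and le: "\<And>n. Lp_norm q (h n) \<le> ennreal (D * \<rho> ^ n)"
      and AE: "AE x in lebesgue_on unit_cube. ennreal \<bar>f x\<bar> \<le> (\<Sum>n. ennreal \<bar>h n x\<bar>)"
    have "AE x in lebesgue_on unit_cube. \<forall>n. \<bar>h n x\<bar> \<le> D * \<rho> ^ n"
      unfolding AE_all_countable using le D \<rho> PInf by (auto intro!: AE_le_Lp_norm_infinity)
    with AE have "AE x in lebesgue_on unit_cube. \<bar>f x\<bar> \<le> 1 / (1 - \<rho>) * D"
    proof eventually_elim
      case (elim x)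
      have "ennreal \<bar>f x\<bar> \<le> (\<Sum>n. ennreal \<bar>h n x\<bar>)" using elim by simp
      also have "\<dots> \<le> (\<Sum>n. ennreal (D * \<rho> ^ n))" using elim by (intro suminf_le) (auto intro: ennreal_leI)
      also have "\<dots> = ennreal (D * (1 / (1 - \<rho>)))"
        using \<rho> D by (intro suminf_ennreal_eq sums_mult geometric_sums) auto
      finally show ?case using \<rho> D by (subst (asm) ennreal_le_iff) (auto simp: mult.commute)
    qed
    then show "Lp_norm q f \<le> ennreal (1 / (1 - \<rho>) * D)"
      unfolding PInf using f by (rule Lp_norm_infinity_le[rotated])
  qed (use \<rho> in simp)
qed (use q in auto)

text \<open>The integrals of the \<open>p\<close>-th powers of the errors are summable, so the
  pointwise sum is finite almost everywhere and its terms tend to 0. The geometric rate gives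
  convergence of the full sequence instead of a subsequence.\<close>

lemma AE_tendsto_of_Lp_norm_geometric:
  fixes s :: "real ^ 'd::finite \<Rightarrow> real"
  assumes p: "0 < p" and \<rho>: "0 < \<rho>" "\<rho> < 1" and D: "0 \<le> D"
    and m: "s \<in> borel_measurable (lebesgue_on unit_cube)" "\<And>n. P n \<in> borel_measurable (lebesgue_on unit_cube)"
    and le: "\<And>n. Lp_norm (ereal p) (\<lambda>x. s x - P n x) \<le> ennreal (D * \<rho> ^ n)"
  shows "AE x in lebesgue_on unit_cube. (\<lambda>n. P n x) \<longlonglongrightarrow> s x"
proof -
  note m[measurable]
  have "\<rho> powr p < 1" using \<rho> p powr_less_mono2[of p \<rho> 1] by simp
  have "(\<integral>\<^sup>+x. (\<Sum>n. ennreal (\<bar>s x - P n x\<bar> powr p)) \<partial>lebesgue_on unit_cube)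
      = (\<Sum>n. \<integral>\<^sup>+x. ennreal (\<bar>s x - P n x\<bar> powr p) \<partial>lebesgue_on unit_cube)"
    by (rule nn_integral_suminf) measurable
  also have "\<dots> \<le> (\<Sum>n. ennreal (D powr p * (\<rho> powr p) ^ n))"
  proof (rule suminf_le)
    fix n
    have "(D * \<rho> ^ n) powr p = D powr p * (\<rho> powr p) ^ n"
      using \<rho> D by (induction n) (simp_all add: powr_mult mult_ac)
    then show "(\<integral>\<^sup>+x. ennreal (\<bar>s x - P n x\<bar> powr p) \<partial>lebesgue_on unit_cube) \<le> ennreal (D powr p * (\<rho> powr p) ^ n)"
      using le[of n] p \<rho> D by (simp add: Lp_norm_le_iff)
  qed auto
  also have "\<dots> = ennreal (D powr p * (1 / (1 - \<rho> powr p)))"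
    using \<open>\<rho> powr p < 1\<close> by (intro suminf_ennreal_eq sums_mult geometric_sums) auto
  also have "\<dots> < \<infinity>" by simp
  finally have "AE x in lebesgue_on unit_cube. (\<Sum>n. ennreal (\<bar>s x - P n x\<bar> powr p)) \<noteq> \<infinity>"
    by (intro nn_integral_noteq_infinite) auto
  then show ?thesis
  proof eventually_elim
    case (elim x)
    then have "summable (\<lambda>n. \<bar>s x - P n x\<bar> powr p)"
      by (intro summable_suminf_not_top) auto
    then have "(\<lambda>n. (\<bar>s x - P n x\<bar> powr p) powr (1 / p)) \<longlonglongrightarrow> 0 powr (1 / p)"
      using p by (intro tendsto_powr2 summable_LIMSEQ_zero) auto
    then have "(\<lambda>n. \<bar>s x - P n x\<bar>) \<longlonglongrightarrow> 0" using p by (simp add: powr_powr)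
    then have "(\<lambda>n. s x - P n x) \<longlonglongrightarrow> 0" by (rule tendsto_rabs_zero_cancel)
    then have "(\<lambda>n. s x - (s x - P n x)) \<longlonglongrightarrow> s x - 0" by (intro tendsto_intros)
    then show ?case by simp
  qed
qed

text \<open>Twice the larger of the two moduli bounds the difference pointwise; this gives a
  quasi-triangle inequality for all \<open>p > 0\<close> at once.\<close>

lemma Lp_norm_diff_le:
  fixes f g :: "real ^ 'd::finite \<Rightarrow> real"
  assumes p: "0 < p" and A: "0 \<le> A"
    and m: "f \<in> borel_measurable (lebesgue_on unit_cube)" "g \<in> borel_measurable (lebesgue_on unit_cube)"
    and le: "Lp_norm (ereal p) f \<le> ennreal A" "Lp_norm (ereal p) g \<le> ennreal A"
  shows "Lp_norm (ereal p) (\<lambda>x. f x - g x) \<le> ennreal (2 * 2 powr (1 / p) * A)"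
proof -
  note m[measurable]
  have "(\<integral>\<^sup>+x. ennreal (\<bar>f x - g x\<bar> powr p) \<partial>lebesgue_on unit_cube)
      \<le> (\<integral>\<^sup>+x. ennreal (2 powr p) * (ennreal (\<bar>f x\<bar> powr p) + ennreal (\<bar>g x\<bar> powr p)) \<partial>lebesgue_on unit_cube)"
  proof (rule nn_integral_mono)
    fix x
    have "\<bar>f x - g x\<bar> powr p \<le> (2 * max \<bar>f x\<bar> \<bar>g x\<bar>) powr p" using p by (intro powr_mono2) auto
    also have "\<dots> = 2 powr p * max \<bar>f x\<bar> \<bar>g x\<bar> powr p" by (simp add: powr_mult)
    also have "\<dots> \<le> 2 powr p * (\<bar>f x\<bar> powr p + \<bar>g x\<bar> powr p)"
      by (intro mult_left_mono) (auto simp: max_def)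
    finally show "ennreal (\<bar>f x - g x\<bar> powr p) \<le> ennreal (2 powr p) * (ennreal (\<bar>f x\<bar> powr p) + ennreal (\<bar>g x\<bar> powr p))"
      by (simp add: ennreal_mult[symmetric] ennreal_plus[symmetric] ennreal_leI del: ennreal_plus)
  qed
  also have "\<dots> = ennreal (2 powr p) * ((\<integral>\<^sup>+x. ennreal (\<bar>f x\<bar> powr p) \<partial>lebesgue_on unit_cube)
      + (\<integral>\<^sup>+x. ennreal (\<bar>g x\<bar> powr p) \<partial>lebesgue_on unit_cube))"
    by (simp add: nn_integral_cmult nn_integral_add)
  also have "\<dots> \<le> ennreal (2 powr p) * (ennreal (A powr p) + ennreal (A powr p))"
    using le p A by (intro mult_left_mono add_mono) (simp_all add: Lp_norm_le_iff)
  also have "\<dots> = ennreal ((2 * 2 powr (1 / p) * A) powr p)"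
    using p A by (simp add: ennreal_mult[symmetric] ennreal_plus[symmetric] powr_mult powr_powr del: ennreal_plus)
  finally show ?thesis using p A by (subst Lp_norm_le_iff) auto
qed

text \<open>Splitting according to \<open>\<bar>f x\<bar> \<le> A\<close> on a set of measure 1
  gives two contributions \<open>A powr q\<close>. This elementary comparison costs the factor
  \<open>2 powr (1 / q)\<close>.\<close>

lemma Lp_norm_le_of_larger_exponent:
  fixes f :: "real ^ 'd::finite \<Rightarrow> real"
  assumes q: "0 < q" "q \<le> r" and A: "0 < A"
    and m: "f \<in> borel_measurable (lebesgue_on unit_cube)"
    and le: "Lp_norm (ereal r) f \<le> ennreal A"
  shows "Lp_norm (ereal q) f \<le> ennreal (2 powr (1 / q) * A)"
proof -
  note m[measurable]
  have "(\<integral>\<^sup>+x. ennreal (\<bar>f x\<bar> powr q) \<partial>lebesgue_on unit_cube)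
      \<le> (\<integral>\<^sup>+x. ennreal (A powr q) + ennreal (A powr (q - r)) * ennreal (\<bar>f x\<bar> powr r) \<partial>lebesgue_on unit_cube)"
  proof (rule nn_integral_mono)
    fix x
    have "\<bar>f x\<bar> powr q \<le> A powr q + A powr (q - r) * \<bar>f x\<bar> powr r"
    proof (cases "\<bar>f x\<bar> \<le> A")
      case True
      then have "\<bar>f x\<bar> powr q \<le> A powr q" using q by (intro powr_mono2) auto
      then show ?thesis by (simp add: add_increasing2)
    next
      case False
      have "\<bar>f x\<bar> powr q = \<bar>f x\<bar> powr (q - r) * \<bar>f x\<bar> powr r" by (simp add: powr_add[symmetric])
      also have "\<dots> \<le> A powr (q - r) * \<bar>f x\<bar> powr r"
        using False q A by (intro mult_right_mono powr_mono2') auto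
      finally show ?thesis by (simp add: add_increasing)
    qed
    then show "ennreal (\<bar>f x\<bar> powr q) \<le> ennreal (A powr q) + ennreal (A powr (q - r)) * ennreal (\<bar>f x\<bar> powr r)"
      by (simp add: ennreal_mult[symmetric] ennreal_plus[symmetric] ennreal_leI del: ennreal_plus)
  qed
  also have "\<dots> = ennreal (A powr q) + ennreal (A powr (q - r)) * (\<integral>\<^sup>+x. ennreal (\<bar>f x\<bar> powr r) \<partial>lebesgue_on unit_cube)"
    using emeasure_unit_cube[where 'd = 'd] by (simp add: nn_integral_add nn_integral_cmult emeasure_restrict_space)
  also have "\<dots> \<le> ennreal (A powr q) + ennreal (A powr (q - r)) * ennreal (A powr r)"
    using le q A by (intro add_mono mult_left_mono) (simp_all add: Lp_norm_le_iff)
  also have "\<dots> = ennreal ((2 powr (1 / q) * A) powr q)"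
    using q A by (simp add: ennreal_mult[symmetric] ennreal_plus[symmetric] powr_mult powr_powr powr_add[symmetric] del: ennreal_plus)
  finally show ?thesis using q A by (subst Lp_norm_le_iff) auto
qed

section \<open>Piecewise polynomials\<close>

lemma poly_on_subset: "poly_on r K f \<Longrightarrow> K' \<subseteq> K \<Longrightarrow> poly_on r K' f"
  unfolding poly_on_def by blast

lemma poly_on_cong:
  assumes "poly_on r K f" "\<And>x. x \<in> K \<Longrightarrow> f x = g x"
  shows "poly_on r K g"
proof -
  obtain a where "\<And>x. x \<in> K \<Longrightarrow> f x = box_polynomial r a x"
    using assms(1) unfolding poly_on_def box_polynomial_def by blast
  then show ?thesis
    using assms(2) unfolding poly_on_def box_polynomial_def[symmetric] by (intro exI[of _ a]) simp
qed

lemma poly_on_diff: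
  assumes "poly_on r K f" "poly_on r K g"
  shows "poly_on r K (\<lambda>x. f x - g x)"
proof -
  obtain a b where "\<And>x. x \<in> K \<Longrightarrow> f x = box_polynomial r a x" "\<And>x. x \<in> K \<Longrightarrow> g x = box_polynomial r b x"
    using assms unfolding poly_on_def box_polynomial_def by blast
  then show ?thesis unfolding poly_on_def
    by (intro exI[of _ "\<lambda>\<alpha>. a \<alpha> - b \<alpha>"]) (simp add: box_polynomial_def sum_subtractf left_diff_distrib)
qed

lemma lborel_measurable_lebesgue_on:
  "f \<in> borel_measurable borel \<Longrightarrow> f \<in> borel_measurable (lebesgue_on S)"
  by (intro measurable_restrict_space1 measurable_completion) simp

lemma dyadic_rectangles_borel: "K \<in> dyadic_rectangles \<Longrightarrow> K \<in> sets borel"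
  by (auto simp: dyadic_rectangles_def dyadic_rectangles_of_level_eq)

lemma dyadic_partition_of_level: "dyadic_partition (dyadic_rectangles_of_level u)"
  unfolding dyadic_partition_def
proof (intro conjI)
  show "partition_on unit_cube (dyadic_rectangles_of_level u)"
  proof (rule partition_onI)
    show "\<Union>(dyadic_rectangles_of_level u) = unit_cube"
      using dyadic_cell_self dyadic_cell_subset by (fastforce simp: dyadic_rectangles_of_level_eq)
    show "{} \<notin> dyadic_rectangles_of_level u"
      using dyadic_cell_self by (fastforce simp: dyadic_rectangles_of_level_eq)
  qed (auto simp: disjnt_def dest: disjoint_dyadic_cells)
qed (auto simp: finite_dyadic_rectangles_of_level dyadic_rectangles_def)

lemma dyadic_partition_measurable:
  fixes f :: "real ^ 'd::finite \<Rightarrow> real"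
  assumes m: "dyadic_partition m"
    and f: "\<And>K. K \<in> m \<Longrightarrow> \<exists>g \<in> borel_measurable (lebesgue_on unit_cube). \<forall>x\<in>K. f x = g x"
  shows "f \<in> borel_measurable (lebesgue_on unit_cube)"
proof (rule measurable_piecewise_restrict[of m])
  show "countable m" using m by (simp add: dyadic_partition_def countable_finite)
  show "space (lebesgue_on unit_cube) \<subseteq> \<Union>m" using m by (auto simp: dyadic_partition_def partition_on_def)
  fix K assume K: "K \<in> m"
  then have "K \<in> dyadic_rectangles" "K \<subseteq> unit_cube"
    using m by (auto simp: dyadic_partition_def partition_on_def)
  moreover from this have "K \<in> sets lebesgue"
    by (intro sets_completionI_sets) (simp add: dyadic_rectangles_borel)
  ultimately show "K \<inter> space (lebesgue_on unit_cube) \<in> sets (lebesgue_on unit_cube)"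
    by (auto simp: sets_restrict_space)
  obtain g where g: "g \<in> borel_measurable (lebesgue_on unit_cube)" "\<forall>x\<in>K. f x = g x" using f[OF K] by blast
  have "g \<in> borel_measurable (restrict_space (lebesgue_on unit_cube) K)" by (rule measurable_restrict_space1[OF g(1)])
  then show "f \<in> borel_measurable (restrict_space (lebesgue_on unit_cube) K)"
    by (rule measurable_cong[THEN iffD2, rotated]) (use g in \<open>auto simp: space_restrict_space\<close>)
qed

lemma piecewise_poly_measurable:
  fixes f :: "real ^ 'd::finite \<Rightarrow> real"
  assumes "dyadic_partition m" "f \<in> piecewise_poly m r"
  shows "f \<in> borel_measurable (lebesgue_on unit_cube)"
proof (rule dyadic_partition_measurable[OF assms(1)])
  fix K assume "K \<in> m"
  then obtain a where "\<forall>x\<in>K. f x = box_polynomial r a x"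
    using assms(2) unfolding piecewise_poly_def poly_on_def box_polynomial_def by blast
  then show "\<exists>g \<in> borel_measurable (lebesgue_on unit_cube). \<forall>x\<in>K. f x = g x"
    using lborel_measurable_lebesgue_on borel_measurable_box_polynomial by blast
qed

lemma Lp_norm_mono:
  fixes f g :: "real ^ 'd::finite \<Rightarrow> real"
  assumes "0 < p" "0 \<le> A" "\<And>x. x \<in> unit_cube \<Longrightarrow> \<bar>f x\<bar> \<le> \<bar>g x\<bar>" "Lp_norm (ereal p) g \<le> ennreal A"
  shows "Lp_norm (ereal p) f \<le> ennreal A"
proof -
  have "(\<integral>\<^sup>+x. ennreal (\<bar>f x\<bar> powr p) \<partial>lebesgue_on unit_cube) \<le> (\<integral>\<^sup>+x. ennreal (\<bar>g x\<bar> powr p) \<partial>lebesgue_on unit_cube)"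
    using assms by (intro nn_integral_mono ennreal_leI powr_mono2) auto
  then show ?thesis using assms by (simp add: Lp_norm_le_iff)
qed

text \<open>Bridge between the norms, which live on \<open>lebesgue_on\<close>, and the affine
  change of variables, which was done in \<open>lborel\<close>: completing a measure leaves
  nonnegative integrals unchanged.\<close>

lemma nn_integral_lebesgue_on_subset:
  assumes "S \<in> sets lebesgue" "K \<subseteq> S"
  shows "(\<integral>\<^sup>+x. F x * indicator K x \<partial>lebesgue_on S) = (\<integral>\<^sup>+x. F x * indicator K x \<partial>lborel)"
proof -
  have "(\<integral>\<^sup>+x. F x * indicator K x \<partial>lebesgue_on S) = (\<integral>\<^sup>+x. F x * indicator K x * indicator S x \<partial>lebesgue)"
    using assms(1) by (subst nn_integral_restrict_space) auto
  also have "\<dots> = (\<integral>\<^sup>+x. F x * indicator K x * indicator S x \<partial>lborel)" by (rule nn_integral_completion)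
  also have "\<dots> = (\<integral>\<^sup>+x. F x * indicator K x \<partial>lborel)"
    using assms(2) by (intro nn_integral_cong) (auto simp: indicator_def)
  finally show ?thesis .
qed

text \<open>A Chebyshev-type count: by \<open>polynomial_sup_le_Lp\<close>, a cell where
  \<open>\<bar>g\<bar>\<close> exceeds \<open>M\<close> at even one point carries, up to the factor
  \<open>C\<close>, an integral of at least \<open>M powr p\<close> times its volume, while disjoint
  cells share the total \<open>A powr p\<close>. \<open>C\<close> is uniform in the level
  \<open>u\<close>.\<close>

lemma card_cells_exceeding:
  fixes r :: "'d::finite \<Rightarrow> nat"
  assumes p: "0 < p"
  obtains C where "0 < C" "\<And>g u F A M. g \<in> borel_measurable (lebesgue_on (unit_cube :: (real ^ 'd) set)) \<Longrightarrow>
      F \<subseteq> dyadic_rectangles_of_level u \<Longrightarrow> (\<And>K. K \<in> F \<Longrightarrow> poly_on r K g) \<Longrightarrow>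
      (\<And>K. K \<in> F \<Longrightarrow> \<exists>x\<in>K. M < \<bar>g x\<bar>) \<Longrightarrow> 0 < M \<Longrightarrow> 0 < A \<Longrightarrow>
      Lp_norm (ereal p) g \<le> ennreal A \<Longrightarrow>
      real (card F) \<le> C * 2 ^ (\<Sum>l\<in>UNIV. u l) * (A / M) powr p"
proof -
  obtain C where C: "0 < C"
    "\<And>(K :: (real ^ 'd) set) f x. convex K \<Longrightarrow> K \<in> sets borel \<Longrightarrow> poly_on r K f \<Longrightarrow> x \<in> K \<Longrightarrow>
      ennreal (\<bar>f x\<bar> powr p) * emeasure lborel K
        \<le> ennreal C * (\<integral>\<^sup>+y. ennreal (\<bar>f y\<bar> powr p) * indicator K y \<partial>lborel)"
    using polynomial_sup_le_Lp[OF p, of r] by blast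
  show ?thesis
  proof (rule that[OF C(1)])
    fix g :: "real ^ 'd \<Rightarrow> real" and u :: "'d \<Rightarrow> nat" and F A M
    assume g[measurable]: "g \<in> borel_measurable (lebesgue_on unit_cube)"
      and F: "F \<subseteq> dyadic_rectangles_of_level u" and pol: "\<And>K. K \<in> F \<Longrightarrow> poly_on r K g"
      and ex: "\<And>K. K \<in> F \<Longrightarrow> \<exists>x\<in>K. M < \<bar>g x\<bar>" and M: "0 < M" and A: "0 < A"
      and le: "Lp_norm (ereal p) g \<le> ennreal A"
    have fin: "finite F" using F finite_dyadic_rectangles_of_level finite_subset by blast
    have K: "K \<in> sets borel" "convex K" "K \<subseteq> unit_cube" "emeasure lborel K = ennreal (1 / 2 ^ (\<Sum>l\<in>UNIV. u l))"
      if "K \<in> F" for K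
      using that F dyadic_cell_subset convex_dyadic_cell
      by (auto simp: dyadic_rectangles_of_level_eq emeasure_dyadic_cell dest!: subsetD)
    have [measurable]: "K \<in> sets (lebesgue_on unit_cube)" if "K \<in> F" for K
      using K[OF that] by (auto simp: sets_restrict_space intro!: image_eqI[of _ _ K])
    have "ennreal (M powr p * (1 / 2 ^ (\<Sum>l\<in>UNIV. u l)))
        \<le> ennreal C * (\<integral>\<^sup>+y. ennreal (\<bar>g y\<bar> powr p) * indicator K y \<partial>lebesgue_on unit_cube)" if KF: "K \<in> F" for K
    proof -
      obtain x where x: "x \<in> K" "M < \<bar>g x\<bar>" using ex[OF KF] by blast
      have "ennreal (M powr p * (1 / 2 ^ (\<Sum>l\<in>UNIV. u l))) = ennreal (M powr p) * emeasure lborel K"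
        by (subst K(4)[OF KF]) (rule ennreal_mult, auto)
      also have "\<dots> \<le> ennreal (\<bar>g x\<bar> powr p) * emeasure lborel K"
        using x M p by (intro mult_right_mono ennreal_leI powr_mono2) auto
      also have "\<dots> \<le> ennreal C * (\<integral>\<^sup>+y. ennreal (\<bar>g y\<bar> powr p) * indicator K y \<partial>lborel)"
        using C(2) K[OF KF] pol[OF KF] x by blast
      finally show ?thesis using K(3)[OF KF] by (simp add: nn_integral_lebesgue_on_subset)
    qed
    then have "(\<Sum>K\<in>F. ennreal (M powr p * (1 / 2 ^ (\<Sum>l\<in>UNIV. u l))))
        \<le> (\<Sum>K\<in>F. ennreal C * (\<integral>\<^sup>+y. ennreal (\<bar>g y\<bar> powr p) * indicator K y \<partial>lebesgue_on unit_cube))"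
      by (rule sum_mono)
    also have "\<dots> = ennreal C * (\<integral>\<^sup>+y. (\<Sum>K\<in>F. ennreal (\<bar>g y\<bar> powr p) * indicator K y) \<partial>lebesgue_on unit_cube)"
      by (subst nn_integral_sum) (auto simp: sum_distrib_left)
    also have "\<dots> \<le> ennreal C * (\<integral>\<^sup>+y. ennreal (\<bar>g y\<bar> powr p) \<partial>lebesgue_on unit_cube)"
    proof (intro mult_left_mono nn_integral_mono)
      fix y
      \<comment> \<open>By disjointness at most one indicator is nonzero at
        \<open>y\<close>.\<close>
      have "(\<Sum>K\<in>F. indicator K y :: ennreal) \<le> 1"
      proof (cases "\<exists>K\<in>F. y \<in> K")
        case True
        then obtain K where K: "K \<in> F" "y \<in> K" by blast
        have "indicator K' y = (0::ennreal)" if "K' \<in> F - {K}" for K'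
          using that K F disjoint_dyadic_cells[of K u K'] by (auto simp: indicator_def)
        then have "(\<Sum>K\<in>F. indicator K y :: ennreal) = indicator K y"
          using K fin by (simp add: sum.remove[of F K])
        then show ?thesis using K by simp
      next
        case False
        then show ?thesis by (auto intro!: order_trans[OF eq_refl[OF sum.neutral]])
      qed
      then have "ennreal (\<bar>g y\<bar> powr p) * (\<Sum>K\<in>F. indicator K y) \<le> ennreal (\<bar>g y\<bar> powr p) * 1"
        by (intro mult_left_mono) auto
      then show "(\<Sum>K\<in>F. ennreal (\<bar>g y\<bar> powr p) * indicator K y) \<le> ennreal (\<bar>g y\<bar> powr p)"
        by (simp add: sum_distrib_left)
    qed auto
    also have "\<dots> \<le> ennreal C * ennreal (A powr p)"
      using le p A by (intro mult_left_mono) (simp_all add: Lp_norm_le_iff)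
    finally have "ennreal (real (card F) * (M powr p * (1 / 2 ^ (\<Sum>l\<in>UNIV. u l)))) \<le> ennreal (C * A powr p)"
      using C(1) by (simp add: ennreal_mult ennreal_of_nat_eq_real_of_nat del: times_divide_eq_right mult_1_right)
    then have "real (card F) * (M powr p * (1 / 2 ^ (\<Sum>l\<in>UNIV. u l))) \<le> C * A powr p"
      using C(1) by (subst (asm) ennreal_le_iff) auto
    then show "real (card F) \<le> C * 2 ^ (\<Sum>l\<in>UNIV. u l) * (A / M) powr p"
      using M A by (simp add: powr_divide field_simps)
  qed
qed

section \<open>Adaptive approximation\<close>

definition aniso_level :: "('d::finite \<Rightarrow> real) \<Rightarrow> nat \<Rightarrow> 'd \<Rightarrow> nat"
  where "aniso_level \<sigma> j l = nat \<lfloor>real j * sigma_min \<sigma> / \<sigma> l\<rfloor>"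

lemma aniso_partition_eq: "aniso_partition \<sigma> j = dyadic_rectangles_of_level (aniso_level \<sigma> j)"
  by (simp add: aniso_partition_def aniso_level_def[abs_def])

lemma sigma_min_le: "sigma_min \<sigma> \<le> \<sigma> l"
  by (simp add: sigma_min_def)

lemma sigma_min_pos: "(\<And>l. 0 < \<sigma> l) \<Longrightarrow> 0 < sigma_min \<sigma>"
  by (simp add: sigma_min_def)

lemma aniso_level_le_Suc:
  assumes "\<And>l. 0 < \<sigma> l"
  shows "aniso_level \<sigma> j \<le> aniso_level \<sigma> (Suc j)"
proof (rule le_funI)
  fix l
  have "real j * sigma_min \<sigma> / \<sigma> l \<le> real (Suc j) * sigma_min \<sigma> / \<sigma> l"
    using assms[of l] sigma_min_pos[of \<sigma>, OF assms] by (intro divide_right_mono mult_right_mono) auto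
  then show "aniso_level \<sigma> j l \<le> aniso_level \<sigma> (Suc j) l"
    unfolding aniso_level_def by (intro nat_mono floor_mono)
qed

text \<open>Since \<open>sigma_min \<sigma> / \<sigma> l \<le> 1\<close>, the floor rises by at most
  1 per level: a refinement halves a cell at most once in each direction.\<close>

lemma aniso_level_Suc_le:
  assumes "\<And>l. 0 < \<sigma> l"
  shows "aniso_level \<sigma> (Suc j) l \<le> Suc (aniso_level \<sigma> j l)"
proof -
  have "sigma_min \<sigma> / \<sigma> l \<le> 1" using assms[of l] sigma_min_le[of \<sigma> l] by simp
  moreover have "real (Suc j) * sigma_min \<sigma> / \<sigma> l = real j * sigma_min \<sigma> / \<sigma> l + sigma_min \<sigma> / \<sigma> l"
    by (simp add: distrib_right add_divide_distrib)
  moreover have "0 \<le> real j * sigma_min \<sigma> / \<sigma> l" using assms[of l] sigma_min_pos[of \<sigma>, OF assms] by simp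
  ultimately show ?thesis unfolding aniso_level_def by linarith
qed

text \<open>Dropping the floors gives the growth rate of the number of cells with the level; the
  parenthesised factor becomes \<open>\<kappa>\<close> below.\<close>

lemma aniso_level_sum_le:
  assumes "\<And>l. 0 < \<sigma> l"
  shows "real (\<Sum>l\<in>UNIV. aniso_level \<sigma> j l) \<le> real j * (sigma_min \<sigma> * (\<Sum>l\<in>UNIV. 1 / \<sigma> l))"
proof -
  have "real (aniso_level \<sigma> j l) \<le> real j * sigma_min \<sigma> / \<sigma> l" for l
  proof -
    have "0 \<le> real j * sigma_min \<sigma> / \<sigma> l" using assms[of l] sigma_min_pos[of \<sigma>, OF assms] by simp
    then show ?thesis unfolding aniso_level_def by simp
  qed
  then have "(\<Sum>l\<in>UNIV. real (aniso_level \<sigma> j l)) \<le> (\<Sum>l\<in>UNIV. real j * sigma_min \<sigma> / \<sigma> l)"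
    by (rule sum_mono)
  then show ?thesis by (simp add: sum_distrib_left mult.assoc)
qed

text \<open>As \<open>R > 0\<close>, doubling the bound makes it strictly larger than the infimum,
  so an approximant exists without any claim that the infimum is attained.\<close>

lemma near_best_approximant:
  assumes R: "0 < R" and e: "approx_error r \<sigma> (ereal p) n s \<le> ennreal (R * 2 powr - (real n * sigma_min \<sigma>))"
  obtains P where "P \<in> piecewise_poly (aniso_partition \<sigma> n) r"
    "Lp_norm (ereal p) (\<lambda>x. s x - P x) \<le> ennreal (2 * R * 2 powr - (real n * sigma_min \<sigma>))"
proof -
  have "R * 2 powr - (real n * sigma_min \<sigma>) < 2 * R * 2 powr - (real n * sigma_min \<sigma>)"
    using R by simp
  then have "approx_error r \<sigma> (ereal p) n s < ennreal (2 * R * 2 powr - (real n * sigma_min \<sigma>))"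
    using R by (intro le_less_trans[OF e]) (simp add: ennreal_less_iff)
  then show ?thesis using that unfolding approx_error_def INF_less_iff by (meson less_imp_le)
qed

text \<open>Nestedness makes the increment between two consecutive approximants a single polynomial
  on each cell of the finer level.\<close>

lemma poly_on_refined_cell:
  assumes \<sigma>: "\<And>l. 0 < \<sigma> l" and P: "P \<in> piecewise_poly (aniso_partition \<sigma> j) r"
    and K: "K \<in> aniso_partition \<sigma> (Suc j)"
  shows "poly_on r K P"
proof -
  obtain x where x: "x \<in> unit_cube" "K = dyadic_cell (aniso_level \<sigma> (Suc j)) x"
    using K by (auto simp: aniso_partition_eq dyadic_rectangles_of_level_eq)
  have "dyadic_cell (aniso_level \<sigma> j) x \<in> aniso_partition \<sigma> j"
    using x by (auto simp: aniso_partition_eq dyadic_rectangles_of_level_eq)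
  then have "poly_on r (dyadic_cell (aniso_level \<sigma> j) x) P" using P by (auto simp: piecewise_poly_def)
  then show ?thesis
    unfolding x(2) by (rule poly_on_subset) (rule dyadic_cell_mono[OF x(1) aniso_level_le_Suc[of \<sigma>, OF \<sigma>]])
qed

lemma two_powr_power: "(2 powr a) ^ n = (2::real) powr (a * real n)"
  by (subst powr_realpow[symmetric]) (simp_all add: powr_powr)

lemma stopped_telescope:
  fixes v :: "nat \<Rightarrow> real"
  assumes "J \<le> t" "t \<le> J + k"
  shows "v (J + k) - v t = (\<Sum>n<k. if t < J + n + 1 then v (J + n + 1) - v (J + n) else 0)"
  using assms(2)
proof (induction k)
  case 0
  then show ?case using assms(1) by simp
next
  case (Suc k)
  show ?case
  proof (cases "t \<le> J + k")
    case True
    with Suc.IH show ?thesis by simp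
  next
    case False
    then have t: "t = J + Suc k" using Suc.prems by simp
    then have "(\<Sum>n<Suc k. if t < J + n + 1 then v (J + n + 1) - v (J + n) else 0) = 0"
      by (intro sum.neutral) auto
    with t show ?thesis by simp
  qed
qed

lemma adaptive_approximation:
  fixes \<sigma> :: "'d::finite \<Rightarrow> real" and p :: real and q :: ereal
  assumes \<sigma>: "\<And>l. 0 < \<sigma> l" and p: "0 < p" "ereal p < q"
    and cond: "1 / p - real_of_ereal (1 / q) < harmonic_mean \<sigma> / real CARD('d)"
  obtains C where "0 < C" "\<And>R s k. 0 < R \<Longrightarrow> s \<in> borel_measurable (lebesgue_on unit_cube) \<Longrightarrow>
      (\<And>n. approx_error r \<sigma> (ereal p) n s \<le> ennreal (R * 2 powr - (real n * sigma_min \<sigma>))) \<Longrightarrow>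
      \<exists>m. dyadic_partition m \<and> real (card m) \<le> 3 / 2 * 2 ^ (k * CARD('d)) \<and>
        (\<exists>t\<in>piecewise_poly m r. Lp_norm q (\<lambda>x. s x - t x)
          \<le> ennreal (C * R * 2 powr - (real k * harmonic_mean \<sigma>)))"
proof -

  \<comment> \<open>Exponents and constants, fixed before \<open>R\<close>, \<open>s\<close> and
    \<open>k\<close>\<close>
  define d where "d = CARD('d)"
  define H where "H = harmonic_mean \<sigma>"
  define s0 where "s0 = sigma_min \<sigma>"
  \<comment> \<open>Level \<open>j\<close> has at most \<open>2 powr (j * \<kappa>)\<close> cells.
    The identity \<open>H * \<kappa> = d * s0\<close> converts numbers of cells into rates of
    approximation.\<close>
  define \<kappa> where "\<kappa> = s0 * (\<Sum>l\<in>UNIV. 1 / \<sigma> l)"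
  define \<theta> where "\<theta> = 1 / p - real_of_ereal (1 / q)"
  have d0: "d > 0" by (simp add: d_def)
  have s0: "s0 > 0" unfolding s0_def by (rule sigma_min_pos[of \<sigma>, OF \<sigma>])
  have S0: "(\<Sum>l\<in>UNIV. 1 / \<sigma> l) > 0" using \<sigma> by (intro sum_pos) auto
  have \<kappa>0: "\<kappa> > 0" using s0 S0 by (simp add: \<kappa>_def)
  have H: "H = real d / (\<Sum>l\<in>UNIV. 1 / \<sigma> l)"
    using d0 by (simp add: H_def harmonic_mean_def d_def field_simps)
  have H\<kappa>: "H * \<kappa> = real d * s0" using S0 by (simp add: H \<kappa>_def)
  have \<theta>0: "\<theta> > 0"
  proof (cases q)
    case (real x)
    then have "p < x" using p by simp
    then show ?thesis using p real by (simp add: \<theta>_def one_ereal_def frac_less2)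
  qed (use p in \<open>auto simp: \<theta>_def\<close>)
  have "\<theta> < H / real d" using cond by (simp add: \<theta>_def H_def d_def)
  also have "\<dots> = s0 / \<kappa>" using H\<kappa> d0 \<kappa>0 by (simp add: field_simps)
  finally have "\<theta> * \<kappa> < s0" using \<kappa>0 by (simp add: pos_less_divide_eq)
  \<comment> \<open>The strict inequality leaves the gap
    \<open>s0 - \<theta> * \<kappa> = 2 * \<eta>\<close>. One half, in the form
    \<open>\<theta> * \<delta> = \<eta>\<close>, lets the thresholds grow so that the numbers of bad
    cells decay; the other half is the decay rate of the error terms.\<close>
  define \<delta> where "\<delta> = (s0 / \<theta> - \<kappa>) / 2"
  define \<eta> where "\<eta> = (s0 - \<theta> * \<kappa>) / 2"
  have \<eta>0: "\<eta> > 0" using \<open>\<theta> * \<kappa> < s0\<close> by (simp add: \<eta>_def)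
  have \<delta>\<eta>: "\<theta> * \<delta> = \<eta>" using \<theta>0 by (simp add: \<delta>_def \<eta>_def field_simps)
  then have \<delta>0: "\<delta> > 0" using \<theta>0 \<eta>0 by (metis zero_less_mult_pos)
  have s0_eq: "s0 = \<theta> * \<kappa> + 2 * \<eta>" by (simp add: \<eta>_def field_simps)
  define \<rho> where "\<rho> = 2 powr - \<delta>"
  have \<rho>: "0 < \<rho>" "\<rho> < 1" using \<delta>0 by (simp_all add: \<rho>_def powr_less_one)
  define \<rho>' where "\<rho>' = 2 powr - \<eta>"
  have \<rho>': "0 < \<rho>'" "\<rho>' < 1" using \<eta>0 by (simp_all add: \<rho>'_def powr_less_one)
  obtain CN where CN: "0 < CN"
    "\<And>g u F A M. g \<in> borel_measurable (lebesgue_on (unit_cube :: (real ^ 'd) set)) \<Longrightarrow>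
      F \<subseteq> dyadic_rectangles_of_level u \<Longrightarrow> (\<And>K. K \<in> F \<Longrightarrow> poly_on r K g) \<Longrightarrow>
      (\<And>K. K \<in> F \<Longrightarrow> \<exists>x\<in>K. M < \<bar>g x\<bar>) \<Longrightarrow> 0 < M \<Longrightarrow> 0 < A \<Longrightarrow>
      Lp_norm (ereal p) g \<le> ennreal A \<Longrightarrow>
      real (card F) \<le> CN * 2 ^ (\<Sum>l\<in>UNIV. u l) * (A / M) powr p"
    using card_cells_exceeding[OF p(1), of r] by blast
  have q0: "0 < q" using p by (metis ereal_less(2) less_trans)
  obtain CS where CS: "0 < CS" "\<And>D (h :: nat \<Rightarrow> real ^ 'd \<Rightarrow> real) f.
    0 \<le> D \<Longrightarrow> (\<And>n. h n \<in> borel_measurable (lebesgue_on unit_cube)) \<Longrightarrow>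
    f \<in> borel_measurable (lebesgue_on unit_cube) \<Longrightarrow>
    (\<And>n. Lp_norm q (h n) \<le> ennreal (D * \<rho>' ^ n)) \<Longrightarrow>
    (AE x in lebesgue_on unit_cube. ennreal \<bar>f x\<bar> \<le> (\<Sum>n. ennreal \<bar>h n x\<bar>)) \<Longrightarrow>
    Lp_norm q f \<le> ennreal (CS * D)"
    using Lp_norm_le_of_series[OF q0 \<rho>'] by blast
  \<comment> \<open>The factors come from the quasi-triangle inequality, from the doubling in
    \<open>near_best_approximant\<close>, and from the passage from level \<open>i - 1\<close> to
    level \<open>i\<close>.\<close>
  define c1 where "c1 = 2 * 2 powr (1 / p) * 2 * 2 powr s0"
  have c1: "c1 > 0" by (simp add: c1_def)
  \<comment> \<open>Chosen so that the cells created by refinement number at most half of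
    \<open>2 ^ (k * d)\<close>. \<open>B\<close> then carries \<open>\<beta>\<close> into the
    thresholds through \<open>(c1 / B) powr p = 1 / \<beta>\<close>, so the dependence on
    \<open>r\<close> and \<open>q\<close> moves from the cardinality to the error constant.\<close>
  define \<beta> where "\<beta> = 2 * 2 ^ d * CN * \<rho> / (1 - \<rho>)\<^sup>2"
  have \<beta>: "\<beta> > 0" using CN(1) \<rho> by (simp add: \<beta>_def)
  define B where "B = c1 * \<beta> powr (1 / p)"
  have B: "B > 0" using c1 \<beta> by (simp add: B_def)
  have cB: "(c1 / B) powr p = 1 / \<beta>"
    using c1 \<beta> p by (simp add: B_def powr_divide powr_mult powr_powr)
  define E where "E = B powr (p * \<theta>) * c1 powr (1 - p * \<theta>)"
  have E: "E > 0" using B c1 by (simp add: E_def)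
  have "\<exists>m. dyadic_partition m \<and> real (card m) \<le> 3 / 2 * 2 ^ (k * CARD('d)) \<and>
        (\<exists>t\<in>piecewise_poly m r. Lp_norm q (\<lambda>x. s x - t x)
          \<le> ennreal (CS * E * 2 powr s0 * R * 2 powr - (real k * harmonic_mean \<sigma>)))"
    if R: "0 < R" and s: "s \<in> borel_measurable (lebesgue_on unit_cube)"
      and e: "\<And>n. approx_error r \<sigma> (ereal p) n s \<le> ennreal (R * 2 powr - (real n * sigma_min \<sigma>))" for R s k
  proof -
    \<comment> \<open>The largest level with \<open>J * \<kappa> \<le> k * d\<close>, hence with at
      most \<open>2 ^ (k * d)\<close> cells guaranteed. Rounding loses at most one level, which
      costs the factor \<open>2 powr s0\<close> in the error.\<close>
    define J where "J = nat \<lfloor>real k * real d / \<kappa>\<rfloor>"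
    have J: "real J * \<kappa> \<le> real k * real d" "real k * H - s0 \<le> real J * s0"
    proof -
      have "0 \<le> real k * real d / \<kappa>" using \<kappa>0 by simp
      then have J': "real J \<le> real k * real d / \<kappa>" "real k * real d / \<kappa> \<le> real J + 1"
        unfolding J_def by linarith+
      from J'(1) show "real J * \<kappa> \<le> real k * real d" using \<kappa>0 by (simp add: pos_le_divide_eq)
      have "real k * H = real k * real d / \<kappa> * s0" using H\<kappa> \<kappa>0 by (simp add: field_simps)
      also have "\<dots> \<le> (real J + 1) * s0" using J'(2) s0 by (intro mult_right_mono) auto
      finally show "real k * H - s0 \<le> real J * s0" by (simp add: algebra_simps)
    qed
    have "\<exists>Q. Q \<in> piecewise_poly (aniso_partition \<sigma> n) r \<and>
        Lp_norm (ereal p) (\<lambda>x. s x - Q x) \<le> ennreal (2 * R * 2 powr - (real n * s0))" for n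
      unfolding s0_def by (rule near_best_approximant[OF R e[of n]]) blast
    then have "\<exists>P. \<forall>n. P n \<in> piecewise_poly (aniso_partition \<sigma> n) r \<and>
        Lp_norm (ereal p) (\<lambda>x. s x - P n x) \<le> ennreal (2 * R * 2 powr - (real n * s0))"
      by (intro choice allI)
    then obtain P where P: "\<And>n. P n \<in> piecewise_poly (aniso_partition \<sigma> n) r"
      "\<And>n. Lp_norm (ereal p) (\<lambda>x. s x - P n x) \<le> ennreal (2 * R * 2 powr - (real n * s0))" by blast
    have Pm: "P n \<in> borel_measurable (lebesgue_on unit_cube)" for n
      using piecewise_poly_measurable[OF dyadic_partition_of_level] P(1)[of n] by (simp add: aniso_partition_eq)
    define g where "g i x = P i x - P (i - 1) x" for i x
    have gm: "g i \<in> borel_measurable (lebesgue_on unit_cube)" for i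
      unfolding g_def by (intro borel_measurable_diff Pm)
    have gpoly: "poly_on r K (g i)" if i: "0 < i" "K \<in> aniso_partition \<sigma> i" for i K
    proof -
      obtain j where "i = Suc j" using i(1) by (cases i) auto
      moreover have "poly_on r K (P i)" using P(1)[of i] i(2) by (simp add: piecewise_poly_def)
      ultimately show ?thesis
        unfolding g_def[abs_def] using poly_on_refined_cell[of \<sigma>, OF \<sigma> P(1)[of j]] i(2) by (simp add: poly_on_diff)
    qed
    define A where "A i = c1 * R * 2 powr - (real i * s0)" for i
    have A: "A i > 0" for i using c1 R by (simp add: A_def)
    have gnorm: "Lp_norm (ereal p) (g i) \<le> ennreal (A i)" if "0 < i" for i
    proof -
      obtain j where j: "i = Suc j" using \<open>0 < i\<close> by (cases i) auto
      define a where "a = 2 * R * 2 powr - (real j * s0)"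
      have "2 * R * 2 powr - (real i * s0) \<le> a" using R s0 j by (simp add: a_def algebra_simps)
      then have 1: "Lp_norm (ereal p) (\<lambda>x. s x - P i x) \<le> ennreal a"
        using P(2)[of i] by (meson ennreal_leI order_trans)
      have 2: "Lp_norm (ereal p) (\<lambda>x. s x - P j x) \<le> ennreal a" using P(2)[of j] by (simp add: a_def)
      have "Lp_norm (ereal p) (\<lambda>x. (s x - P j x) - (s x - P i x)) \<le> ennreal (2 * 2 powr (1 / p) * a)"
        by (rule Lp_norm_diff_le[OF p(1) _ _ _ 2 1]) (use R s Pm in \<open>auto simp: a_def\<close>)
      also have "2 * 2 powr (1 / p) * a = A i"
        by (simp add: A_def a_def c1_def j algebra_simps powr_add[symmetric])
      finally show ?thesis by (simp add: g_def[abs_def] j)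
    qed
    \<comment> \<open>The exponent is solved from the counting bound:
      \<open>(A i / M i) powr p\<close> cancels the factor \<open>2 powr (i * \<kappa>)\<close> for
      the number of cells and leaves \<open>2 ^ (k * d) * \<rho> ^ (i - J)\<close> up to a
      constant.\<close>
    define M where "M i = B * R * 2 powr (- (real i * s0) + (real i * \<kappa> - real k * real d + real (i - J) * \<delta>) / p)" for i
    have M: "M i > 0" for i using B R by (simp add: M_def)
    define X where "X i = {x \<in> unit_cube. M i < \<bar>g i x\<bar>}" for i
    define b where "b = CN / \<beta> * 2 ^ (k * d)"
    have cX: "real (card {K \<in> dyadic_rectangles_of_level (aniso_level \<sigma> i). K \<inter> X i \<noteq> {}}) \<le> b * \<rho> ^ (i - J)"
      if "J < i" for i
    proof -
      have "real (card {K \<in> dyadic_rectangles_of_level (aniso_level \<sigma> i). K \<inter> X i \<noteq> {}})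
          \<le> CN * 2 ^ (\<Sum>l\<in>UNIV. aniso_level \<sigma> i l) * (A i / M i) powr p"
      proof (rule CN(2)[OF gm[of i]])
        show "poly_on r K (g i)" if "K \<in> {K \<in> dyadic_rectangles_of_level (aniso_level \<sigma> i). K \<inter> X i \<noteq> {}}" for K
          using that \<open>J < i\<close> by (intro gpoly) (auto simp: aniso_partition_eq)
        show "Lp_norm (ereal p) (g i) \<le> ennreal (A i)" using \<open>J < i\<close> by (intro gnorm) simp
      qed (use M A in \<open>auto simp: X_def\<close>)
      also have "\<dots> \<le> CN * 2 powr (real i * \<kappa>) * (A i / M i) powr p"
      proof (intro mult_right_mono mult_left_mono)
        have "(2::real) ^ (\<Sum>l\<in>UNIV. aniso_level \<sigma> i l) = 2 powr real (\<Sum>l\<in>UNIV. aniso_level \<sigma> i l)"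
          by (rule powr_realpow[symmetric]) simp
        also have "\<dots> \<le> 2 powr (real i * \<kappa>)"
          using aniso_level_sum_le[of \<sigma> i, OF \<sigma>] by (intro powr_mono) (simp_all add: \<kappa>_def s0_def)
        finally show "(2::real) ^ (\<Sum>l\<in>UNIV. aniso_level \<sigma> i l) \<le> 2 powr (real i * \<kappa>)" .
      qed (use CN(1) in auto)
      also have "A i / M i = (c1 / B) * 2 powr (- ((real i * \<kappa> - real k * real d + real (i - J) * \<delta>) / p))"
      proof -
        define y where "y = (real i * \<kappa> - real k * real d + real (i - J) * \<delta>) / p"
        define z :: real where "z = 2 powr - (real i * s0)"
        have "M i = B * R * (z * 2 powr y)" unfolding M_def z_def y_def by (simp only: powr_add)
        moreover have "z > 0" by (simp add: z_def)
        ultimately show ?thesis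
          using R B unfolding A_def y_def[symmetric] z_def[symmetric] by (simp add: powr_minus field_simps)
      qed
      also have "\<dots> powr p = (c1 / B) powr p * 2 powr (- (real i * \<kappa> - real k * real d + real (i - J) * \<delta>))"
      proof -
        have "- ((real i * \<kappa> - real k * real d + real (i - J) * \<delta>) / p) * p
            = - (real i * \<kappa> - real k * real d + real (i - J) * \<delta>)" using p by simp
        then show ?thesis using c1 B by (subst powr_mult) (auto simp only: powr_powr intro: divide_nonneg_nonneg less_imp_le)
      qed
      also have "CN * 2 powr (real i * \<kappa>) * ((c1 / B) powr p * 2 powr (- (real i * \<kappa> - real k * real d + real (i - J) * \<delta>)))
          = CN / \<beta> * (2 powr (real i * \<kappa>) * 2 powr (- (real i * \<kappa> - real k * real d + real (i - J) * \<delta>)))"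
        by (simp add: cB)
      also have "2 powr (real i * \<kappa>) * 2 powr (- (real i * \<kappa> - real k * real d + real (i - J) * \<delta>))
          = 2 powr (real (k * d)) * 2 powr (- \<delta> * real (i - J))"
        by (simp add: powr_add[symmetric] algebra_simps)
      also have "2 powr (real (k * d)) = (2::real) ^ (k * d)" by (rule powr_realpow) simp
      also have "2 powr (- \<delta> * real (i - J)) = \<rho> ^ (i - J)" by (simp only: \<rho>_def two_powr_power)
      finally show ?thesis by (simp add: b_def mult.assoc)
    qed
    obtain m \<tau> N where m: "dyadic_partition m"
      and card: "real (card m) \<le> 2 ^ (\<Sum>l\<in>UNIV. aniso_level \<sigma> J l) + 2 ^ CARD('d) * (b * \<rho> / (1 - \<rho>)\<^sup>2)"
      and cells: "\<And>K. K \<in> m \<Longrightarrow> \<exists>j. K \<in> dyadic_rectangles_of_level (aniso_level \<sigma> j) \<and> (\<forall>x\<in>K. \<tau> x = j)"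
      and \<tau>J: "\<And>x. x \<in> unit_cube \<Longrightarrow> J \<le> \<tau> x"
      and \<tau>N: "\<And>x. x \<in> unit_cube \<Longrightarrow> \<tau> x \<le> N"
      and \<tau>X: "\<And>x i. x \<in> unit_cube \<Longrightarrow> \<tau> x < i \<Longrightarrow> x \<notin> X i"
      using adaptive_dyadic_partition[of "aniso_level \<sigma>" \<rho> J X b, OF aniso_level_le_Suc[of \<sigma>, OF \<sigma>] aniso_level_Suc_le[of \<sigma>, OF \<sigma>] \<rho> cX]
      by blast
    have "(2::real) ^ (\<Sum>l\<in>UNIV. aniso_level \<sigma> J l) = 2 powr real (\<Sum>l\<in>UNIV. aniso_level \<sigma> J l)"
      by (rule powr_realpow[symmetric]) simp
    also have "\<dots> \<le> 2 powr real (k * d)"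
      using aniso_level_sum_le[of \<sigma> J, OF \<sigma>] J(1) by (intro powr_mono) (simp_all add: \<kappa>_def s0_def)
    also have "\<dots> = (2::real) ^ (k * d)" by (rule powr_realpow) simp
    finally have base: "(2::real) ^ (\<Sum>l\<in>UNIV. aniso_level \<sigma> J l) \<le> 2 ^ (k * d)" .
    have extra: "2 ^ CARD('d) * (b * \<rho> / (1 - \<rho>)\<^sup>2) = 1 / 2 * 2 ^ (k * d)"
      using CN(1) \<rho> by (simp add: b_def \<beta>_def d_def)
    have "real (card m) \<le> 2 ^ (\<Sum>l\<in>UNIV. aniso_level \<sigma> J l) + 1 / 2 * 2 ^ (k * d)"
      using card unfolding extra .
    also have "\<dots> \<le> 2 ^ (k * d) + 1 / 2 * 2 ^ (k * d)" by (rule add_right_mono[OF base])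
    also have "\<dots> = 3 / 2 * (2::real) ^ (k * CARD('d))" by (simp add: d_def)
    finally have card': "real (card m) \<le> 3 / 2 * 2 ^ (k * CARD('d))" .

    \<comment> \<open>The stopped approximant and its error\<close>
    define t where "t x = P (\<tau> x) x" for x
    have t: "t \<in> piecewise_poly m r" unfolding piecewise_poly_def
    proof (intro CollectI ballI)
      fix K assume "K \<in> m"
      then obtain j where j: "K \<in> aniso_partition \<sigma> j" "\<And>x. x \<in> K \<Longrightarrow> \<tau> x = j"
        unfolding aniso_partition_eq using cells by blast
      then have "poly_on r K (P j)" using P(1)[of j] by (simp add: piecewise_poly_def)
      then show "poly_on r K t" by (rule poly_on_cong) (simp add: t_def j(2))
    qed
    \<comment> \<open>The part of the increment into level \<open>J + n + 1\<close> that the stopped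
      approximant omits. Points that have stopped earlier lie outside \<open>X (J + n + 1)\<close>,
      so this part is bounded by the threshold; on each cell of \<open>m\<close> it is either the
      whole increment or 0.\<close>
    define h where "h n x = (if x \<in> unit_cube \<and> \<tau> x < J + n + 1 then g (J + n + 1) x else 0)" for n x
    have hm: "h n \<in> borel_measurable (lebesgue_on unit_cube)" for n
    proof (rule dyadic_partition_measurable[OF m])
      fix K assume K: "K \<in> m"
      then obtain j where j: "\<And>x. x \<in> K \<Longrightarrow> \<tau> x = j" using cells by blast
      have "K \<subseteq> unit_cube" using K m by (auto simp: dyadic_partition_def partition_on_def)
      then have "\<forall>x\<in>K. h n x = (if j < J + n + 1 then g (J + n + 1) else (\<lambda>_. 0)) x"
        using j by (auto simp: h_def)
      then show "\<exists>g\<in>borel_measurable (lebesgue_on unit_cube). \<forall>x\<in>K. h n x = g x"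
        using gm by (intro bexI[of _ "if j < J + n + 1 then g (J + n + 1) else (\<lambda>_. 0)"]) simp_all
    qed
    have hM: "\<bar>h n x\<bar> \<le> M (J + n + 1)" if "x \<in> unit_cube" for n x
    proof (cases "\<tau> x < J + n + 1")
      case True
      then have "x \<notin> X (J + n + 1)" using \<tau>X that by blast
      then show ?thesis using that True by (simp add: X_def h_def)
    qed (use M[of "J + n + 1"] in \<open>simp add: h_def\<close>)
    have hA: "Lp_norm (ereal p) (h n) \<le> ennreal (A (J + n + 1))" for n
    proof (rule Lp_norm_mono[OF p(1)])
      show "Lp_norm (ereal p) (g (J + n + 1)) \<le> ennreal (A (J + n + 1))" by (rule gnorm) simp
      show "0 \<le> A (J + n + 1)" using A by (rule less_imp_le)
    qed (simp add: h_def)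
    define D where "D = E * R * 2 powr - (real J * s0)"
    have hq: "Lp_norm q (h n) \<le> ennreal (D * \<rho>' ^ n)" for n
    proof -
      define i where "i = J + n + 1"
      define y where "y = real i * \<kappa> - real k * real d + real (i - J) * \<delta>"
      have "Lp_norm q (h n) \<le> ennreal (M i powr (p * \<theta>) * A i powr (1 - p * \<theta>))"
        by (rule Lp_norm_interpolation[OF hm p M A]) (use hM hA in \<open>auto simp: i_def \<theta>_def\<close>)
      also have "M i powr (p * \<theta>) * A i powr (1 - p * \<theta>) \<le> D * \<rho>' ^ n"
      proof -
        have "M i powr (p * \<theta>) = B powr (p * \<theta>) * R powr (p * \<theta>) * 2 powr ((- (real i * s0) + y / p) * (p * \<theta>))"
          using B R by (simp add: M_def y_def powr_mult powr_powr)
        moreover have "A i powr (1 - p * \<theta>) = c1 powr (1 - p * \<theta>) * R powr (1 - p * \<theta>) * 2 powr (- (real i * s0) * (1 - p * \<theta>))"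
          using c1 R by (simp add: A_def powr_mult powr_powr)
        ultimately have "M i powr (p * \<theta>) * A i powr (1 - p * \<theta>)
          = E * (R powr (p * \<theta>) * R powr (1 - p * \<theta>))
            * (2 powr ((- (real i * s0) + y / p) * (p * \<theta>)) * 2 powr (- (real i * s0) * (1 - p * \<theta>)))"
          by (simp add: E_def mult_ac)
        also have "R powr (p * \<theta>) * R powr (1 - p * \<theta>) = R" using R by (simp add: powr_add[symmetric])
        also have "2 powr ((- (real i * s0) + y / p) * (p * \<theta>)) * 2 powr (- (real i * s0) * (1 - p * \<theta>))
            = 2 powr (- (real i * s0) + \<theta> * y)"
        proof -
          have "(- (real i * s0) + y / p) * (p * \<theta>) + - (real i * s0) * (1 - p * \<theta>) = - (real i * s0) + \<theta> * y"
            using p by (simp add: field_simps)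
          then show ?thesis by (simp only: powr_add[symmetric])
        qed
        also have "\<dots> \<le> 2 powr (- (real J * s0) + - \<eta> * real n)"
        proof (rule powr_mono)
          have i: "real i = real J + real n + 1" "real (i - J) = real n + 1" by (simp_all add: i_def)
          \<comment> \<open>The contribution of the starting level is split off and is nonpositive
            by the choice of \<open>J\<close>; what is left is compared with
            \<open>s0 = \<theta> * \<kappa> + 2 * \<eta>\<close>, so that one \<open>\<eta>\<close>
            per level survives as decay.\<close>
          have "\<theta> * y = \<theta> * (real J * \<kappa> - real k * real d) + (real n + 1) * (\<theta> * \<kappa> + \<theta> * \<delta>)"
            by (simp add: y_def i algebra_simps)
          also have "\<theta> * (real J * \<kappa> - real k * real d) \<le> 0" using \<theta>0 J(1) by (simp add: mult_nonneg_nonpos)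
          finally have "\<theta> * y \<le> (real n + 1) * (\<theta> * \<kappa> + \<eta>)" by (simp add: \<delta>\<eta>)
          then have "- (real i * s0) + \<theta> * y \<le> - (real J * s0) - (real n + 1) * s0 + (real n + 1) * (\<theta> * \<kappa> + \<eta>)"
            by (simp add: i algebra_simps)
          also have "\<dots> = - (real J * s0) - (real n + 1) * \<eta>" by (simp add: s0_eq algebra_simps)
          also have "\<dots> \<le> - (real J * s0) + - \<eta> * real n" using \<eta>0 by (simp add: algebra_simps)
          finally show "- (real i * s0) + \<theta> * y \<le> - (real J * s0) + - \<eta> * real n" .
        qed simp
        also have "\<dots> = 2 powr - (real J * s0) * \<rho>' ^ n"
          by (simp only: \<rho>'_def two_powr_power powr_add)
        finally show ?thesis using E R by (simp add: D_def mult_ac mult_left_mono)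
      qed
      finally show ?thesis by (simp add: ennreal_leI)
    qed
    have conv: "AE x in lebesgue_on unit_cube. (\<lambda>n. P n x) \<longlonglongrightarrow> s x"
    proof (rule AE_tendsto_of_Lp_norm_geometric[OF p(1) _ _ _ s Pm])
      show "Lp_norm (ereal p) (\<lambda>x. s x - P n x) \<le> ennreal (2 * R * (2 powr - s0) ^ n)" for n
        using P(2)[of n] by (simp add: two_powr_power mult.commute)
    qed (use R s0 in \<open>simp_all add: powr_less_one\<close>)
    have "AE x in lebesgue_on unit_cube. ennreal \<bar>s x - t x\<bar> \<le> (\<Sum>n. ennreal \<bar>h n x\<bar>)"
      using conv AE_space
    proof eventually_elim
      case (elim x)
      then have x: "x \<in> unit_cube" by simp
      have "(\<lambda>k. P (k + J) x) \<longlonglongrightarrow> s x" using elim(1) by (rule LIMSEQ_ignore_initial_segment)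
      then have lim: "(\<lambda>k. ennreal \<bar>P (k + J) x - t x\<bar>) \<longlonglongrightarrow> ennreal \<bar>s x - t x\<bar>" by (intro tendsto_intros)
      \<comment> \<open>Telescoping requires \<open>\<tau> x \<le> J + k\<close>, which
        \<open>N \<le> k\<close> ensures; a bound for all large \<open>k\<close> passes to the
        limit.\<close>
      have bd: "ennreal \<bar>P (k + J) x - t x\<bar> \<le> (\<Sum>n. ennreal \<bar>h n x\<bar>)" if "N \<le> k" for k
      proof -
        have "P (J + k) x - t x = (\<Sum>n<k. if \<tau> x < J + n + 1 then P (J + n + 1) x - P (J + n) x else 0)"
          unfolding t_def
          by (rule stopped_telescope[of J "\<tau> x" k "\<lambda>n. P n x"]) (use \<tau>J[OF x] \<tau>N[OF x] that in auto)
        also have "\<dots> = (\<Sum>n<k. h n x)" using x by (intro sum.cong) (auto simp: h_def g_def)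
        finally have "ennreal \<bar>P (k + J) x - t x\<bar> \<le> ennreal (\<Sum>n<k. \<bar>h n x\<bar>)"
          by (simp add: add.commute ennreal_leI sum_abs)
        also have "\<dots> = (\<Sum>n<k. ennreal \<bar>h n x\<bar>)" by simp
        also have "\<dots> \<le> (\<Sum>n. ennreal \<bar>h n x\<bar>)" by (rule sum_le_suminf) auto
        finally show ?thesis .
      qed
      show ?case by (rule LIMSEQ_le_const2[OF lim]) (intro exI[of _ N] allI impI bd)
    qed
    then have "Lp_norm q (\<lambda>x. s x - t x) \<le> ennreal (CS * D)"
      using E R s piecewise_poly_measurable[OF m t] by (intro CS(2)[of D h, OF _ hm _ hq]) (simp_all add: D_def)
    also have "CS * D \<le> CS * E * 2 powr s0 * R * 2 powr - (real k * harmonic_mean \<sigma>)"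
    proof -
      have "2 powr - (real J * s0) \<le> (2::real) powr (s0 + - (real k * H))"
        using J(2) by (intro powr_mono) auto
      also have "\<dots> = 2 powr s0 * 2 powr - (real k * H)" by (rule powr_add)
      finally have "CS * E * R * 2 powr - (real J * s0) \<le> CS * E * R * (2 powr s0 * 2 powr - (real k * H))"
        using CS(1) E R by (intro mult_left_mono) auto
      then show ?thesis by (simp add: D_def H_def mult_ac)
    qed
    finally have "Lp_norm q (\<lambda>x. s x - t x) \<le> ennreal (CS * E * 2 powr s0 * R * 2 powr - (real k * harmonic_mean \<sigma>))"
      by (simp add: ennreal_leI)
    with m card' t show ?thesis by blast
  qed
  then show ?thesis using CS(1) E by (intro that[of "CS * E * 2 powr s0"]) auto
qed

lemma adaptive_approximation_all_exponents:
  fixes \<sigma> :: "'d::finite \<Rightarrow> real" and p :: real and q :: ereal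
  assumes \<sigma>: "\<And>l. 0 < \<sigma> l" and p: "0 < p" and q: "0 < q"
    and cond: "1 / p - real_of_ereal (1 / q) < harmonic_mean \<sigma> / real CARD('d)"
  obtains C where "0 < C" "\<And>R s k. 0 < R \<Longrightarrow> s \<in> borel_measurable (lebesgue_on unit_cube) \<Longrightarrow>
      (\<And>n. approx_error r \<sigma> (ereal p) n s \<le> ennreal (R * 2 powr - (real n * sigma_min \<sigma>))) \<Longrightarrow>
      \<exists>m. dyadic_partition m \<and> real (card m) \<le> 3 / 2 * 2 ^ (k * CARD('d)) \<and>
        (\<exists>t\<in>piecewise_poly m r. Lp_norm q (\<lambda>x. s x - t x)
          \<le> ennreal (C * R * 2 powr - (real k * harmonic_mean \<sigma>)))"
proof (cases "ereal p < q")
  case True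
  show ?thesis by (rule adaptive_approximation[of \<sigma> p q r, OF \<sigma> p True cond]) (rule that, assumption, blast)
next
  case False
  then obtain x where x: "q = ereal x" "0 < x" "x \<le> p" using q by (cases q) auto
  \<comment> \<open>The auxiliary exponent \<open>y\<close> is given by
    \<open>1 / y = 1 / p - \<mu>\<close>: \<open>\<mu> > 0\<close> makes it larger than
    \<open>p\<close>, \<open>\<mu> < 1 / p\<close> keeps it finite and positive, and
    \<open>\<mu> < H / d\<close> is the smoothness condition for it.\<close>
  define \<mu> where "\<mu> = min (harmonic_mean \<sigma> / real CARD('d)) (1 / p) / 2"
  have "0 < (\<Sum>l\<in>UNIV. 1 / \<sigma> l)" using \<sigma> by (intro sum_pos) auto
  then have \<mu>: "0 < \<mu>" "\<mu> < 1 / p" "\<mu> < harmonic_mean \<sigma> / real CARD('d)"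
    using p by (auto simp: \<mu>_def harmonic_mean_def min_def field_simps)
  define y where "y = 1 / (1 / p - \<mu>)"
  have y: "p < y" "1 / y = 1 / p - \<mu>" using \<mu> p by (auto simp: y_def field_simps)
  have yp: "ereal p < ereal y" using y(1) by simp
  have yc: "1 / p - real_of_ereal (1 / ereal y) < harmonic_mean \<sigma> / real CARD('d)"
    using y \<mu>(3) p by (simp add: one_ereal_def)
  obtain C where C: "0 < C" "\<And>R s k. 0 < R \<Longrightarrow> s \<in> borel_measurable (lebesgue_on unit_cube) \<Longrightarrow>
      (\<And>n. approx_error r \<sigma> (ereal p) n s \<le> ennreal (R * 2 powr - (real n * sigma_min \<sigma>))) \<Longrightarrow>
      \<exists>m. dyadic_partition m \<and> real (card m) \<le> 3 / 2 * 2 ^ (k * CARD('d)) \<and>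
        (\<exists>t\<in>piecewise_poly m r. Lp_norm (ereal y) (\<lambda>x. s x - t x)
          \<le> ennreal (C * R * 2 powr - (real k * harmonic_mean \<sigma>)))"
    by (rule adaptive_approximation[of \<sigma> p "ereal y" r, OF \<sigma> p yp yc]) blast
  show ?thesis
  proof (rule that[of "2 powr (1 / x) * C"])
    fix R s k
    assume R: "0 < R" and s: "s \<in> borel_measurable (lebesgue_on (unit_cube :: (real ^ 'd) set))"
      and e: "\<And>n. approx_error r \<sigma> (ereal p) n s \<le> ennreal (R * 2 powr - (real n * sigma_min \<sigma>))"
    obtain m t where m: "dyadic_partition m" "real (card m) \<le> 3 / 2 * 2 ^ (k * CARD('d))"
      and t: "t \<in> piecewise_poly m r"
        "Lp_norm (ereal y) (\<lambda>x. s x - t x) \<le> ennreal (C * R * 2 powr - (real k * harmonic_mean \<sigma>))"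
      using C(2)[OF R s e] by blast
    have "Lp_norm q (\<lambda>x. s x - t x) \<le> ennreal (2 powr (1 / x) * (C * R * 2 powr - (real k * harmonic_mean \<sigma>)))"
      unfolding x(1)
      by (rule Lp_norm_le_of_larger_exponent[OF x(2) _ _ _ t(2)])
        (use x y(1) C(1) R s piecewise_poly_measurable[OF m(1) t(1)] in auto)
    then show "\<exists>m. dyadic_partition m \<and> real (card m) \<le> 3 / 2 * 2 ^ (k * CARD('d)) \<and>
        (\<exists>t\<in>piecewise_poly m r. Lp_norm q (\<lambda>x. s x - t x)
          \<le> ennreal (2 powr (1 / x) * C * R * 2 powr - (real k * harmonic_mean \<sigma>)))"
      using m t(1) by (auto simp: mult.assoc)
  qed (use C(1) in simp)
qed

section \<open>From the Besov ball to one partition valid for all radii\<close>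

lemma ennreal_powr_le_imp_le:
  assumes "0 < a" "0 \<le> R" "ennreal_powr (\<Sum>k. ennreal_powr (f k) a) (1 / a) \<le> ennreal R"
  shows "f n \<le> ennreal R"
proof -
  \<comment> \<open>\<open>ennreal_powr\<close> maps infinity to infinity, so the finite bound
    forces the series, and then each of its terms, to be real.\<close>
  obtain v where v: "(\<Sum>k. ennreal_powr (f k) a) = ennreal v" "0 \<le> v"
    using assms(3) by (cases "\<Sum>k. ennreal_powr (f k) a") (auto simp: ennreal_powr_def top_unique)
  have "sum g {n} \<le> suminf g" for g :: "nat \<Rightarrow> ennreal" by (rule sum_le_suminf) auto
  from this[of "\<lambda>k. ennreal_powr (f k) a"] have le: "ennreal_powr (f n) a \<le> ennreal v" by (simp add: v(1))
  then obtain w where w: "f n = ennreal w" "0 \<le> w"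
    by (cases "f n") (auto simp: ennreal_powr_def top_unique)
  then have "w powr a \<le> v" using le v(2) by (simp add: ennreal_powr_def)
  then have "(w powr a) powr (1 / a) \<le> v powr (1 / a)" using assms(1) by (intro powr_mono2) auto
  moreover have "v powr (1 / a) \<le> R" using assms v by (simp add: ennreal_powr_def)
  ultimately show ?thesis using assms(1) w by (simp add: powr_powr ennreal_leI)
qed

lemma approx_error_le_of_besov_ball:
  assumes p': "p' = \<infinity> \<or> (\<exists>a>0. p' = ereal a)" and R: "0 \<le> R" and s: "s \<in> besov_ball r \<sigma> p p' R"
  shows "approx_error r \<sigma> p n s \<le> ennreal (R * 2 powr - (real n * sigma_min \<sigma>))"
proof -
  define w :: real where "w = 2 powr (real n * sigma_min \<sigma>)"
  have w: "0 < w" by (simp add: w_def)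
  have N: "besov_seminorm r \<sigma> p p' s \<le> ennreal R" using s by (simp add: besov_ball_def)
  have "ennreal w * approx_error r \<sigma> p n s \<le> ennreal R"
  proof (cases "p' = \<infinity>")
    case True
    then show ?thesis using N unfolding besov_seminorm_def w_def by (auto simp: SUP_le_iff)
  next
    case False
    then obtain a where a: "0 < a" "p' = ereal a" using p' by auto
    then show ?thesis unfolding w_def
      using N by (intro ennreal_powr_le_imp_le[where f = "\<lambda>k. ennreal (2 powr (real k * sigma_min \<sigma>)) * approx_error r \<sigma> p k s" and a = a])
        (simp_all add: besov_seminorm_def R)
  qed
  then have "ennreal (1 / w) * (ennreal w * approx_error r \<sigma> p n s) \<le> ennreal (1 / w) * ennreal R"
    by (rule mult_left_mono) simp
  moreover have "ennreal (1 / w) * ennreal w = 1" using w by (simp add: ennreal_mult[symmetric])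
  then have "ennreal (1 / w) * (ennreal w * approx_error r \<sigma> p n s) = approx_error r \<sigma> p n s"
    by (simp only: mult.assoc[symmetric] mult_1)
  moreover have "ennreal (1 / w) * ennreal R = ennreal (R * (1 / w))"
    using w R by (subst ennreal_mult[symmetric]) (simp_all add: mult.commute)
  moreover have "1 / w = 2 powr - (real n * sigma_min \<sigma>)" by (simp add: w_def powr_minus_divide)
  ultimately show ?thesis by (simp only:)
qed

text \<open>The blocks cover the nonempty cube, so a single block must be the whole of it. This
  identifies the partition for \<open>k = 0\<close>, independently of the radius.\<close>

lemma dyadic_partition_card_le_1:
  fixes m :: "(real ^ 'd::finite) set set"
  assumes "dyadic_partition m" "card m \<le> 1"
  shows "m = {unit_cube}"
proof -
  have m: "finite m" "\<Union>m = unit_cube" using assms(1) by (auto simp: dyadic_partition_def partition_on_def)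
  moreover have "(0 :: real ^ 'd) \<in> unit_cube" by (simp add: mem_unit_cube)
  ultimately have "m \<noteq> {}" by auto
  then have "card m = 1" using m(1) assms(2) by (simp add: card_eq_0_iff le_Suc_eq)
  then obtain K where "m = {K}" by (auto simp: card_1_singleton_iff)
  then show ?thesis using m(2) by simp
qed

theorem theorem1:
  fixes \<sigma> :: "'d::finite \<Rightarrow> real" and p :: real
  assumes "\<forall>l. 0 < \<sigma> l" and "0 < p"
  shows "\<exists>C1>0. \<forall>(r :: 'd \<Rightarrow> nat) (q :: ereal).
    (\<forall>l. \<sigma> l < real (r l) + 1) \<longrightarrow> 1 \<le> q \<longrightarrow>
    max (ereal (1 / p) - 1 / q) 0 < ereal (harmonic_mean \<sigma> / real CARD('d)) \<longrightarrow>
    (\<exists>C2>0. \<forall>s \<in> (\<Union>R\<in>{0<..}. besov_ball r \<sigma> (ereal p) (second_index p q) R). \<forall>k :: nat.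
      \<exists>m. dyadic_partition m \<and>
        real (card m) \<le> C1 * 2 ^ (k * CARD('d)) \<and>
        (\<forall>R>0. s \<in> besov_ball r \<sigma> (ereal p) (second_index p q) R \<longrightarrow>
          (INF t\<in>piecewise_poly m r. Lp_norm q (\<lambda>x. s x - t x))
            \<le> ennreal (C2 * R * 2 powr (- (real k * harmonic_mean \<sigma>)))))"
\<comment> \<open>The value 2 is fixed before \<open>r\<close> and \<open>q\<close>. The
  construction even gives 3/2, which \<open>main\<close> retains because a bound below 2 forces a
  single block when \<open>k = 0\<close>.\<close>
proof (rule exI[of _ 2], intro conjI allI impI)
  fix r :: "'d \<Rightarrow> nat" and q :: ereal
  assume q: "1 \<le> q"
    and cond: "max (ereal (1 / p) - 1 / q) 0 < ereal (harmonic_mean \<sigma> / real CARD('d))"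
  have \<sigma>: "0 < \<sigma> l" for l using assms(1) by blast
  have cond': "1 / p - real_of_ereal (1 / q) < harmonic_mean \<sigma> / real CARD('d)"
    using q cond by (cases q) (auto simp: one_ereal_def zero_ereal_def)
  have q0: "0 < q" using q by (rule less_le_trans[rotated]) simp
  define H where "H = harmonic_mean \<sigma>"
  define S where "S R = besov_ball r \<sigma> (ereal p) (second_index p q) R" for R
  obtain C where C: "0 < C" "\<And>R s k. 0 < R \<Longrightarrow> s \<in> borel_measurable (lebesgue_on unit_cube) \<Longrightarrow>
      (\<And>n. approx_error r \<sigma> (ereal p) n s \<le> ennreal (R * 2 powr - (real n * sigma_min \<sigma>))) \<Longrightarrow>
      \<exists>m. dyadic_partition m \<and> real (card m) \<le> 3 / 2 * 2 ^ (k * CARD('d)) \<and>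
        (\<exists>t\<in>piecewise_poly m r. Lp_norm q (\<lambda>x. s x - t x) \<le> ennreal (C * R * 2 powr - (real k * H)))"
    using adaptive_approximation_all_exponents[of \<sigma> p q r, OF \<sigma> assms(2) q0 cond'] unfolding H_def by blast
  have main: "\<exists>m. dyadic_partition m \<and> real (card m) \<le> 3 / 2 * 2 ^ (k * CARD('d)) \<and>
      (INF t\<in>piecewise_poly m r. Lp_norm q (\<lambda>x. s x - t x)) \<le> ennreal (C * R * 2 powr - (real k * H))"
    if "0 < R" "s \<in> S R" for R s k
  proof -
    have "approx_error r \<sigma> (ereal p) n s \<le> ennreal (R * 2 powr - (real n * sigma_min \<sigma>))" for n
      by (rule approx_error_le_of_besov_ball[where p' = "second_index p q"])
        (use that assms(2) in \<open>auto simp: S_def second_index_def\<close>)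
    moreover have "s \<in> borel_measurable (lebesgue_on unit_cube)"
      using that(2) by (simp add: S_def besov_ball_def Lp_space_def)
    ultimately show ?thesis using C(2)[OF that(1)] by (meson INF_lower order_trans)
  qed
  have "\<exists>m. dyadic_partition m \<and> real (card m) \<le> 2 * 2 ^ (k * CARD('d)) \<and>
      (\<forall>R>0. s \<in> S R \<longrightarrow>
        (INF t\<in>piecewise_poly m r. Lp_norm q (\<lambda>x. s x - t x)) \<le> ennreal (C * R * 2 powr - (real k * H)))"
    if s: "s \<in> S R" and R: "0 < R" for s R k
  proof -
    \<comment> \<open>The seminorm itself is the smallest candidate for a radius. If it is positive,
      the partition built for \<open>v\<close> serves every larger radius, since the error bound
      grows with the radius.\<close>
    define v where "v = enn2real (besov_seminorm r \<sigma> (ereal p) (second_index p q) s)"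
    have "besov_seminorm r \<sigma> (ereal p) (second_index p q) s \<le> ennreal R" using s by (simp add: S_def besov_ball_def)
    then have v: "besov_seminorm r \<sigma> (ereal p) (second_index p q) s = ennreal v" "0 \<le> v"
      by (auto simp: v_def ennreal_enn2real_if top_unique)
    have sS: "s \<in> S R' \<longleftrightarrow> v \<le> R'" if "0 \<le> R'" for R'
      using s that v by (simp add: S_def besov_ball_def)
    show ?thesis
    proof (cases "v = 0")
      case False
      then have "0 < v" "s \<in> S v" using v sS by auto
      from main[OF this, of k] obtain m where m: "dyadic_partition m" "real (card m) \<le> 3 / 2 * 2 ^ (k * CARD('d))"
        "(INF t\<in>piecewise_poly m r. Lp_norm q (\<lambda>x. s x - t x)) \<le> ennreal (C * v * 2 powr - (real k * H))" by blast
      have "ennreal (C * v * 2 powr - (real k * H)) \<le> ennreal (C * R' * 2 powr - (real k * H))" if "0 < R'" "s \<in> S R'" for R'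
        using that sS C(1) by (intro ennreal_leI mult_right_mono mult_left_mono) auto
      moreover have "real (card m) \<le> 2 * 2 ^ (k * CARD('d))"
        using m(2) by (rule order_trans) simp
      ultimately show ?thesis using m by (intro exI[of _ m]) (meson order_trans)
    next
      case True
      \<comment> \<open>All radii are admissible, so the partition must not depend on the radius: for \<open>k = 0\<close>
        the cardinality bound forces the trivial one.\<close>
      have triv: "(INF t\<in>piecewise_poly {unit_cube} r. Lp_norm q (\<lambda>x. s x - t x)) \<le> ennreal (C * R')"
        and dp: "dyadic_partition {unit_cube :: (real ^ 'd) set}" if "0 < R'" for R'
      proof -
        have "s \<in> S R'" using True that sS by simp
        from main[OF that this, of 0] obtain m where m: "dyadic_partition m" "real (card m) \<le> 3 / 2"
          "(INF t\<in>piecewise_poly m r. Lp_norm q (\<lambda>x. s x - t x)) \<le> ennreal (C * R')" by auto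
        have "m = {unit_cube}" using m(1,2) by (intro dyadic_partition_card_le_1) linarith+
        then show "(INF t\<in>piecewise_poly {unit_cube} r. Lp_norm q (\<lambda>x. s x - t x)) \<le> ennreal (C * R')"
          "dyadic_partition {unit_cube :: (real ^ 'd) set}" using m by auto
      qed
      have "(1::real) * 1 \<le> 2 * 2 ^ (k * CARD('d))" by (intro mult_mono one_le_power) auto
      then have "(1::real) \<le> 2 * 2 ^ (k * CARD('d))" by simp
      \<comment> \<open>Every positive radius being admissible, the decay in \<open>k\<close> is
        obtained by applying \<open>triv\<close> to a radius that already contains it.\<close>
      moreover have "(INF t\<in>piecewise_poly {unit_cube} r. Lp_norm q (\<lambda>x. s x - t x)) \<le> ennreal (C * R' * 2 powr - (real k * H))"
        if "0 < R'" for R' using triv[of "R' * 2 powr - (real k * H)"] that by (simp add: mult.assoc)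
      ultimately show ?thesis using dp[OF R] by (intro exI[of _ "{unit_cube}"]) simp
    qed
  qed
  then show "\<exists>C2>0. \<forall>s \<in> (\<Union>R\<in>{0<..}. besov_ball r \<sigma> (ereal p) (second_index p q) R). \<forall>k :: nat.
      \<exists>m. dyadic_partition m \<and>
        real (card m) \<le> 2 * 2 ^ (k * CARD('d)) \<and>
        (\<forall>R>0. s \<in> besov_ball r \<sigma> (ereal p) (second_index p q) R \<longrightarrow>
          (INF t\<in>piecewise_poly m r. Lp_norm q (\<lambda>x. s x - t x))
            \<le> ennreal (C2 * R * 2 powr (- (real k * harmonic_mean \<sigma>))))"
    using C(1) unfolding S_def H_def by (intro exI[of _ C]) auto
qed simp

end
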